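(* Let $l_1,l_2\ge1$ be integers and let $f_{(1,1)}(t)$ be the series obtained from $f_{(1,1)}$ by specializing all variables $s_k$ and $t_l$ to a single variable $t$. Then $$f_{(1,1)}(t)=\Bigl(\sum_{k\ge0}\frac{1}{(l_1l_2-l_1-l_2)k+1}\binom{(l_1-1)(l_2-1)k}{k}(t^2xy)^k\Bigr)^{l_1l_2}.$$
   Context: Let $R=\mathbb{Q}[[s_1,\dots,s_{l_1},t_1,\dots,t_{l_2}]]$ with maximal ideal $\mathfrak m$, and $B=\mathbb{Q}[x^{\pm1},y^{\pm1}]\widehat\otimes R=\mathbb{Q}[x^{\pm1},y^{\pm1}][[s_1,\dots,s_{l_1},t_1,\dots,t_{l_2}]]$. For $(a,b)\in\mathbb{Z}^2$ and $f\in 1+x^ay^b\mathbb{Q}[x^ay^b]\widehat\otimes\mathfrak m$ let $T_{(a,b),f}$ be the $R$-linear automorphism of $B$ with $x\mapsto xf^{-b}$, $y\mapsto yf^{a}$. The tropical vertex group $H\subset{\rm Aut}_R(B)$ is the $\mathfrak m$-adic completion of the subgroup generated by all $T_{(a,b),f}$. By Kontsevich–Soibelman there is a unique factorization in $H$ $$T_{(1,0),\prod_{k=1}^{l_1}(1+s_kx)}\,T_{(0,1),\prod_{l=1}^{l_2}(1+t_ly)}=\prod_{b/a\text{ decreasing}}T_{(a,b),f_{(a,b)}},$$ the ordered product (composition of maps, $(TS)(z)=T(S(z))$) ranging over all coprime $(a,b)\in\mathbb{N}^2$ ($0\in\mathbb{N}$), from $(0,1)$ on the left to $(1,0)$ on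 the right. This defines the series $f_{(a,b)}$.
   Formalization: When l_1=1 or l_2=1, the k=1 coefficient in the printed formula is 1/0 times binom(0,1), which is undefined; it is read here as 1, the value obtained after cancelling the common factor (l_1l_2-l_1-l_2)k+1. *)

theory Defs
  imports
    "HOL-Library.Poly_Mapping"
    "HOL-Library.Product_Plus"
    "HOL-Library.Multiset"
    "HOL-Library.Cardinality"
    "HOL-Computational_Algebra.Formal_Power_Series"
begin

section \<open>Formal power series in several variables\<close>

text \<open>
  Power series over \<open>'a\<close> in commuting variables indexed by \<open>'v\<close>. A monomial is encoded as the
  multiset of its variables, so that the product of monomials is \<open>+\<close>, divisibility is
  \<open>\<subseteq>#\<close>, and the total degree is \<^const>\<open>size\<close>.
\<close>

typedef ('v, 'a) mps = "UNIV :: ('v multiset \<Rightarrow> 'a) set"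
  morphisms mps_nth Abs_mps ..

setup_lifting type_definition_mps

lemma mps_eqI: "(\<And>m. mps_nth f m = mps_nth g m) \<Longrightarrow> f = g"
  by (simp add: mps_nth_inject[symmetric] fun_eq_iff)

definition msplits :: "'v multiset \<Rightarrow> ('v multiset \<times> 'v multiset) set" where
  "msplits m = {(p, q). p + q = m}"

lemma finite_submultisets: "finite {p. p \<subseteq># m}"
proof (rule finite_subset)
  show "{p. p \<subseteq># m} \<subseteq> (\<Union>n\<le>size m. multisets_of_size (set_mset m) n)"
    by (auto simp: multisets_of_size_def size_mset_mono dest: mset_subset_eqD)
qed auto

lemma finite_msplits [simp, intro]: "finite (msplits m)"
proof (rule finite_subset)
  show "msplits m \<subseteq> {p. p \<subseteq># m} \<times> {p. p \<subseteq># m}"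
    by (auto simp: msplits_def)
qed (auto simp: finite_submultisets)

instantiation mps :: (type, comm_ring_1) comm_ring_1
begin

lift_definition zero_mps :: "('a, 'b) mps" is "\<lambda>_. 0" .
lift_definition one_mps :: "('a, 'b) mps" is "\<lambda>m. if m = {#} then 1 else 0" .
lift_definition plus_mps :: "('a, 'b) mps \<Rightarrow> ('a, 'b) mps \<Rightarrow> ('a, 'b) mps"
  is "\<lambda>f g m. f m + g m" .
lift_definition minus_mps :: "('a, 'b) mps \<Rightarrow> ('a, 'b) mps \<Rightarrow> ('a, 'b) mps"
  is "\<lambda>f g m. f m - g m" .
lift_definition uminus_mps :: "('a, 'b) mps \<Rightarrow> ('a, 'b) mps"
  is "\<lambda>f m. - f m" .
lift_definition times_mps :: "('a, 'b) mps \<Rightarrow> ('a, 'b) mps \<Rightarrow> ('a, 'b) mps"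
  is "\<lambda>f g m. \<Sum>(p, q)\<in>msplits m. f p * g q" .

instance
proof
  fix f g h :: "('a, 'b) mps"
  show "f * g * h = f * (g * h)"
  proof (transfer, rule ext)
    fix f g h :: "'a multiset \<Rightarrow> 'b" and m
    have "(\<Sum>(p, q)\<in>msplits m. (\<Sum>(u, v)\<in>msplits p. f u * g v) * h q) =
          (\<Sum>(x, y)\<in>(SIGMA x:msplits m. msplits (fst x)). f (fst y) * g (snd y) * h (snd x))"
      by (subst sum.Sigma[symmetric]) (auto simp: sum_distrib_right case_prod_unfold)
    also have "\<dots> = (\<Sum>(x, y)\<in>(SIGMA x:msplits m. msplits (snd x)). f (fst x) * (g (fst y) * h (snd y)))"
      by (rule sum.reindex_bij_witness
            [of _ "\<lambda>(x, y). ((fst x + fst y, snd y), (fst x, fst y))"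
                  "\<lambda>(x, y). ((fst y, snd y + snd x), (snd y, snd x))"])
         (auto simp: msplits_def algebra_simps)
    also have "\<dots> = (\<Sum>(p, q)\<in>msplits m. f p * (\<Sum>(u, v)\<in>msplits q. g u * h v))"
      by (subst sum.Sigma[symmetric]) (auto simp: sum_distrib_left case_prod_unfold)
    finally show "(\<Sum>(p, q)\<in>msplits m. (\<Sum>(u, v)\<in>msplits p. f u * g v) * h q) =
                  (\<Sum>(p, q)\<in>msplits m. f p * (\<Sum>(u, v)\<in>msplits q. g u * h v))" .
  qed
  show "f * g = g * f"
  proof (transfer, rule ext)
    fix f g :: "'a multiset \<Rightarrow> 'b" and m
    show "(\<Sum>(p, q)\<in>msplits m. f p * g q) = (\<Sum>(p, q)\<in>msplits m. g p * f q)"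
      by (rule sum.reindex_bij_witness[of _ prod.swap prod.swap])
         (auto simp: msplits_def algebra_simps)
  qed
  show "1 * f = f"
  proof (transfer, rule ext)
    fix f :: "'a multiset \<Rightarrow> 'b" and m
    have "(\<Sum>(p, q)\<in>msplits m. (if p = {#} then 1 else 0) * f q) =
          (\<Sum>(p, q)\<in>{({#} :: 'a multiset, m)}. (if p = {#} then 1 else 0) * f q)"
      by (rule sum.mono_neutral_right) (simp, auto simp: msplits_def split: if_splits)
    then show "(\<Sum>(p, q)\<in>msplits m. (if p = {#} then 1 else 0) * f q) = f m"
      by simp
  qed
  show "(f + g) * h = f * h + g * h"
    by transfer (simp add: fun_eq_iff algebra_simps case_prod_unfold sum.distrib)
  show "(0 :: ('a, 'b) mps) \<noteq> 1"
    by transfer (auto simp: fun_eq_iff)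
qed (transfer; simp add: fun_eq_iff algebra_simps)+

end

lift_definition mps_monom :: "'v multiset \<Rightarrow> 'a::zero \<Rightarrow> ('v, 'a) mps"
  is "\<lambda>m c m'. if m' = m then c else 0" .


section \<open>The rings \<open>R\<close> and \<open>B\<close>\<close>

text \<open>The Laurent polynomial ring in \<open>x\<close>, \<open>y\<close>: the group algebra of \<open>\<int>\<^sup>2\<close>.\<close>

type_synonym laurent = "(int \<times> int) \<Rightarrow>\<^sub>0 rat"

text \<open>
  The variables are \<open>s\<^sub>k = Inl k\<close> and \<open>t\<^sub>l = Inr l\<close> with \<open>k :: 'k\<close>, \<open>l :: 'l\<close>, for finite index
  types of cardinalities \<open>l\<^sub>1\<close> and \<open>l\<^sub>2\<close>.
\<close>

type_synonym ('k, 'l) R = "('k + 'l, rat) mps"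
type_synonym ('k, 'l) B = "('k + 'l, laurent) mps"

lift_definition of_R :: "('k, 'l) R \<Rightarrow> ('k, 'l) B"
  is "\<lambda>r m. Poly_Mapping.single 0 (r m)" .

definition xy :: "int \<Rightarrow> int \<Rightarrow> ('k, 'l) B" where
  "xy a b = mps_monom {#} (Poly_Mapping.single (a, b) 1)"

definition svar :: "'k \<Rightarrow> ('k, 'l) B" where
  "svar k = mps_monom {#Inl k#} 1"

definition tvar :: "'l \<Rightarrow> ('k, 'l) B" where
  "tvar l = mps_monom {#Inr l#} 1"

text \<open>The ideal \<open>\<mm>\<^sup>n B\<close>: as there are finitely many variables, it consists of the series all of
  whose terms have total degree at least \<open>n\<close> in the \<open>s\<^sub>k\<close>, \<open>t\<^sub>l\<close>.\<close>

definition max_ideal_power :: "nat \<Rightarrow> ('k, 'l) B set" where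
  "max_ideal_power n = {g. \<forall>m. size m < n \<longrightarrow> mps_nth g m = 0}"

text \<open>The set \<open>1 + x\<^sup>a y\<^sup>b \<rat>[x\<^sup>a y\<^sup>b] \<otimes> \<mm>\<close> (completed tensor product).\<close>

definition vertex_series :: "int \<Rightarrow> int \<Rightarrow> ('k, 'l) B set" where
  "vertex_series a b =
     {f. f - 1 \<in> max_ideal_power 1 \<and>
         (\<forall>m. Poly_Mapping.keys (mps_nth (f - 1) m) \<subseteq> {(int j * a, int j * b) | j :: nat. 1 \<le> j})}"


section \<open>The tropical vertex group\<close>

definition R_algebra_aut :: "(('k, 'l) B \<Rightarrow> ('k, 'l) B) \<Rightarrow> bool" where
  "R_algebra_aut \<phi> \<longleftrightarrow>
     bij \<phi> \<and> \<phi> 1 = 1 \<and>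
     (\<forall>g h. \<phi> (g + h) = \<phi> g + \<phi> h) \<and>
     (\<forall>g h. \<phi> (g * h) = \<phi> g * \<phi> h) \<and>
     (\<forall>r g. \<phi> (of_R r * g) = of_R r * \<phi> g)"

text \<open>Integer powers of a unit of a commutative ring.\<close>

definition unit_powi :: "'a::comm_ring_1 \<Rightarrow> int \<Rightarrow> 'a" where
  "unit_powi u n = (if 0 \<le> n then u ^ nat n else (THE v. u * v = 1) ^ nat (- n))"

text \<open>The description is definite for \<open>f \<in> vertex_series a b\<close>: such an automorphism exists, and it
  is unique because \<open>R\<close>-algebra endomorphisms of \<open>B\<close> preserve each \<open>\<mm>\<^sup>n B\<close>, while
  \<open>B / \<mm>\<^sup>n B\<close> is generated over \<open>R\<close> by \<open>x\<^sup>\<plusminus>\<^sup>1\<close>, \<open>y\<^sup>\<plusminus>\<^sup>1\<close>.\<close>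

definition T :: "int \<Rightarrow> int \<Rightarrow> ('k, 'l) B \<Rightarrow> ('k, 'l) B \<Rightarrow> ('k, 'l) B" where
  "T a b f = (THE \<phi>. R_algebra_aut \<phi> \<and>
                \<phi> (xy 1 0) = xy 1 0 * unit_powi f (- b) \<and>
                \<phi> (xy 0 1) = xy 0 1 * unit_powi f a)"

inductive_set T_subgroup :: "(('k, 'l) B \<Rightarrow> ('k, 'l) B) set" where
  T: "f \<in> vertex_series a b \<Longrightarrow> T a b f \<in> T_subgroup"
| id: "id \<in> T_subgroup"
| comp: "\<phi> \<in> T_subgroup \<Longrightarrow> \<psi> \<in> T_subgroup \<Longrightarrow> \<phi> \<circ> \<psi> \<in> T_subgroup"
| inv: "\<phi> \<in> T_subgroup \<Longrightarrow> inv \<phi> \<in> T_subgroup"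

definition cong_max_ideal_power ::
  "nat \<Rightarrow> (('k, 'l) B \<Rightarrow> ('k, 'l) B) \<Rightarrow> (('k, 'l) B \<Rightarrow> ('k, 'l) B) \<Rightarrow> bool" where
  "cong_max_ideal_power n \<phi> \<psi> \<longleftrightarrow> (\<forall>g. \<phi> g - \<psi> g \<in> max_ideal_power n)"

text \<open>The \<open>\<mm>\<close>-adic completion, realised inside the (complete) group of \<open>R\<close>-algebra automorphisms
  of \<open>B\<close>.\<close>

definition tropical_vertex_group :: "(('k, 'l) B \<Rightarrow> ('k, 'l) B) set" where
  "tropical_vertex_group =
     {\<phi>. R_algebra_aut \<phi> \<and> (\<forall>n. \<exists>\<psi>\<in>T_subgroup. cong_max_ideal_power n \<phi> \<psi>)}"


section \<open>Ordered factorizations\<close>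

definition coprime_pairs :: "(nat \<times> nat) set" where
  "coprime_pairs = {(a, b). coprime a b}"

text \<open>\<open>b / a > b' / a'\<close>, with \<open>(0, 1)\<close> of infinite slope.\<close>

definition slope_gt :: "nat \<times> nat \<Rightarrow> nat \<times> nat \<Rightarrow> bool" where
  "slope_gt p q \<longleftrightarrow> snd p * fst q > snd q * fst p"

definition T_product :: "(nat \<times> nat \<Rightarrow> ('k, 'l) B) \<Rightarrow> (nat \<times> nat) list \<Rightarrow> ('k, 'l) B \<Rightarrow> ('k, 'l) B" where
  "T_product f ps = foldr (\<circ>) (map (\<lambda>p. T (int (fst p)) (int (snd p)) (f p)) ps) id"

text \<open>
  \<open>\<theta>\<close> is the product of all \<open>T\<^bsub>(a,b),f (a,b)\<^esub>\<close> in order of decreasing slope, leftmost factor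
  \<open>(0, 1)\<close>: the net of the ordered products over finite sets of coprime pairs converges to \<open>\<theta>\<close>
  in the \<open>\<mm>\<close>-adic topology. A finite set of coprime pairs is represented by the unique list of its
  elements in order of strictly decreasing slope.
\<close>

definition ordered_factorization ::
  "(('k, 'l) B \<Rightarrow> ('k, 'l) B) \<Rightarrow> (nat \<times> nat \<Rightarrow> ('k, 'l) B) \<Rightarrow> bool" where
  "ordered_factorization \<theta> f \<longleftrightarrow>
     \<theta> \<in> tropical_vertex_group \<and>
     (\<forall>(a, b)\<in>coprime_pairs. f (a, b) \<in> vertex_series (int a) (int b)) \<and>
     (\<forall>n. \<exists>S. finite S \<and> S \<subseteq> coprime_pairs \<and>
        (\<forall>ps. sorted_wrt slope_gt ps \<and> set ps \<subseteq> coprime_pairs \<and> S \<subseteq> set ps \<longrightarrow>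
              cong_max_ideal_power n (T_product f ps) \<theta>))"


section \<open>Specialization and the coefficients\<close>

text \<open>Substituting one variable \<open>t\<close> for all \<open>s\<^sub>k\<close> and \<open>t\<^sub>l\<close>.\<close>

definition specialize :: "('k::finite, 'l::finite) B \<Rightarrow> laurent fps" where
  "specialize f = Abs_fps (\<lambda>n. \<Sum>m\<in>multisets_of_size UNIV n. mps_nth f m)"

text \<open>
  The number \<open>1 / ((l\<^sub>1 l\<^sub>2 - l\<^sub>1 - l\<^sub>2) k + 1) * (((l\<^sub>1 - 1) (l\<^sub>2 - 1) k) choose k)\<close>. For \<open>l\<^sub>1, l\<^sub>2 \<ge> 1\<close>
  the denominator vanishes only if \<open>k = 1\<close> and \<open>l\<^sub>1 = 1\<close> or \<open>l\<^sub>2 = 1\<close>; the expression then reads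
  \<open>0 / 0\<close>. With \<open>N = l\<^sub>1 l\<^sub>2 - l\<^sub>1 - l\<^sub>2\<close> we have \<open>(l\<^sub>1 - 1) (l\<^sub>2 - 1) k = N k + k\<close>, so the factor \<open>N k + 1\<close>
  of the binomial coefficient cancels the denominator, and the value at \<open>0 / 0\<close> is the empty
  product \<open>1\<close>; see \<open>vertex_coeff_altdef\<close>.
\<close>

definition vertex_coeff :: "nat \<Rightarrow> nat \<Rightarrow> nat \<Rightarrow> rat" where
  "vertex_coeff l1 l2 k =
     (let d = (int l1 * int l2 - int l1 - int l2) * int k + 1
      in if d = 0 then 1 else 1 / of_int d * of_nat (((l1 - 1) * (l2 - 1) * k) choose k))"

lemma vertex_coeff_altdef:
  assumes "1 \<le> l1" "1 \<le> l2"
  shows "vertex_coeff l1 l2 k =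
           (\<Prod>i=2..k. of_int ((int l1 * int l2 - int l1 - int l2) * int k + int i)) / fact k"
proof -
  define N where "N = int l1 * int l2 - int l1 - int l2"
  define n where "n = (l1 - 1) * (l2 - 1)"
  have nN: "int n = N + 1"
  proof -
    have "int n = (int l1 - 1) * (int l2 - 1)"
      using assms by (simp only: n_def of_nat_mult of_nat_diff of_nat_1)
    then show ?thesis by (simp add: N_def algebra_simps)
  qed
  have choose: "of_nat ((n * k) choose k) = (\<Prod>i=1..k. of_int (N * int k + int i) :: rat) / fact k"
  proof -
    have "of_nat ((n * k) choose k) = (of_nat (n * k) gchoose k :: rat)"
      by (simp add: binomial_gbinomial)
    also have "\<dots> = (\<Prod>i=0..<k. of_nat (n * k) - of_nat i) / fact k"
      by (simp add: gbinomial_prod_rev)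
    also have "(\<Prod>i=0..<k. of_nat (n * k) - of_nat i :: rat) = (\<Prod>i=1..k. of_int (N * int k + int i))"
    proof (rule prod.reindex_bij_witness[of _ "\<lambda>i. k - i" "\<lambda>i. k - i"])
      fix i assume i: "i \<in> {0..<k}"
      have "of_nat (n * k) = (of_int (int n * int k) :: rat)" by simp
      also have "\<dots> = of_int (N * int k + int k)" by (simp add: nN algebra_simps)
      finally show "of_int (N * int k + int (k - i)) = (of_nat (n * k) - of_nat i :: rat)"
        using i by (simp add: of_nat_diff)
    qed auto
    finally show ?thesis .
  qed
  show ?thesis
  proof (cases "N * int k + 1 = 0")
    case True
    then have "int k dvd 1" by (metis dvd_add_right_iff dvd_triv_right dvd_0_right)
    then have "k = 1" by simp
    then show ?thesis using True by (simp add: vertex_coeff_def N_def)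
  next
    case False
    have ne: "of_int (N * int k + 1) \<noteq> (0 :: rat)" using False by linarith
    have eq: "vertex_coeff l1 l2 k =
            1 / of_int (N * int k + 1) * ((\<Prod>i=1..k. of_int (N * int k + int i)) / fact k)"
      using False choose by (simp add: vertex_coeff_def N_def n_def)
    show ?thesis
    proof (cases "k = 0")
      case True
      then show ?thesis using eq by simp
    next
      case False
      then have "(\<Prod>i=1..k. of_int (N * int k + int i) :: rat) =
              of_int (N * int k + 1) * (\<Prod>i=2..k. of_int (N * int k + int i))"
        by (subst prod.atLeast_Suc_atMost) (simp_all add: numeral_2_eq_2)
      then show ?thesis using eq ne by (simp add: N_def)
    qed
  qed
qed

end

theory Submission
  imports Defs
begin

text \<open>
  Grade \<open>B\<close> by \<open>x\<^sup>a y\<^sup>b \<mapsto> a - b\<close>. A factor of slope greater than 1 changes \<open>x\<close> and \<open>y\<close> only by factors \<open>1 +\<close>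
  (terms of negative degree), a factor of slope less than 1 only by factors \<open>1 +\<close> (terms of positive
  degree), and \<open>xy\<close> has degree 0. So the ordered factorization \<open>\<theta> = \<theta>\<^sub>- \<circ> T\<^bsub>(1,1),f\<^esub> \<circ> \<theta>\<^sub>+\<close> of the
  given product \<open>\<theta>\<close>, with \<open>f = f\<^bsub>(1,1)\<^esub>\<close>, is a Birkhoff factorization, and \<open>f\<close> is its diagonal part.

  Such a factorization can be solved geometrically. View \<open>\<theta>\<close> as the gluing of two charts into a
  surface which contains a family of rational curves that run from \<open>x = 0\<close> in one chart to \<open>x = \<infinity>\<close> in
  the other. A curve, or rather the whole family with parameters \<open>x\<close> and \<open>xy\<close>, is given by an
  endomorphism \<open>\<phi>\<close> of \<open>B\<close>, its parametrization in one chart; in the other chart it is \<open>\<phi> \<circ> \<theta>\<close>.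
  Suppose that \<open>\<phi> x\<close>, \<open>\<phi> y\<close> are \<open>x\<close>, \<open>y\<close> up to factors \<open>1 +\<close> (negative degree), and that \<open>\<phi> (\<theta> x)\<close>,
  \<open>\<phi> (\<theta> y)\<close> are \<open>c x\<close>, \<open>d y\<close> up to terms of higher degree, with \<open>c d = 1\<close>. Composing with factors of
  the two kinds does not change these leading coefficients, so that \<open>\<psi> = \<phi> \<circ> \<theta>\<^sub>-\<close> has the leading
  coefficients \<open>1, 1\<close> at infinity, and \<open>\<psi> \<circ> T\<^bsub>(1,1),f\<^esub>\<close> has \<open>c, d\<close> at 0. A series with
  a leading coefficient at 0 and one at infinity is of degree 0 and equal to both. This forces first
  \<open>\<psi> (xy) = xy\<close> and then \<open>f = d\<close> (\<open>vertex_series_from_leading\<close>).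

  The curves are explicit (\<open>vertex_curve\<close>). In the chart between the two factors of \<open>\<theta>\<close>, they are
  \<open>X = x \<Prod>\<^sub>l (1 + \<beta>\<^sub>l / x)\<close> and \<open>Y = C x\<^sup>-\<^sup>1 \<Prod>\<^sub>k (1 + \<alpha>\<^sub>k x)\<close>: the orders of the poles are dictated by the gluing,
  and the zeros have to cancel those of \<open>1 + t\<^sub>l Y\<close> and \<open>1 + s\<^sub>k X\<close>, which gives
  \<open>\<alpha>\<^sub>k = s\<^sub>k \<Prod>\<^sub>l (1 - \<alpha>\<^sub>k \<beta>\<^sub>l)\<close> and \<open>\<beta>\<^sub>l = C t\<^sub>l \<Prod>\<^sub>k (1 - \<alpha>\<^sub>k \<beta>\<^sub>l)\<close>. In terms of \<open>D\<^sub>k\<^sub>l = 1 / (1 - \<alpha>\<^sub>k \<beta>\<^sub>l)\<close> this is the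
  system \<open>D\<^sub>k\<^sub>l = 1 + s\<^sub>k t\<^sub>l x y \<Prod> D\<^sub>i\<^sub>j\<close> over all \<open>i \<noteq> k\<close>, \<open>j \<noteq> l\<close>, with \<open>C = x y \<Prod> D\<^sub>i\<^sub>j\<close> over all \<open>i, j\<close>. The leading
  coefficient \<open>d\<close> is the product of all \<open>D\<^sub>k\<^sub>l\<close>, whence \<open>f = \<Prod> D\<^sub>k\<^sub>l\<close> (\<open>vertex_series_slope_one\<close>).

  After specialization all \<open>D\<^sub>k\<^sub>l\<close> agree with the solution of \<open>D = 1 + t\<^sup>2 x y D\<^sup>p\<close> with
  \<open>p = (l\<^sub>1 - 1) (l\<^sub>2 - 1)\<close>, the Fuss-Catalan series, whose coefficients are those of the statement
  (\<open>rothe_fps_equation\<close>, \<open>vertex_coeff_eq_rothe\<close>).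
\<close>

(* Keeps the literal 1 in max_ideal_power 1 and filt e 1 n intact. *)
declare One_nat_def [simp del]

section \<open>Multivariate power series\<close>

lemma mps_nth_simps [simp]:
  fixes g h :: "('v, 'a::comm_ring_1) mps"
  shows "mps_nth (g + h) m = mps_nth g m + mps_nth h m"
    and "mps_nth (g - h) m = mps_nth g m - mps_nth h m"
    and "mps_nth (- g) m = - mps_nth g m"
    and "mps_nth (0 :: ('v, 'a) mps) m = 0"
    and "mps_nth (1 :: ('v, 'a) mps) m = (if m = {#} then 1 else 0)"
    and "mps_nth (g * h) m = (\<Sum>(p, q)\<in>msplits m. mps_nth g p * mps_nth h q)"
  by (simp_all add: plus_mps.rep_eq minus_mps.rep_eq uminus_mps.rep_eq zero_mps.rep_eq
      one_mps.rep_eq times_mps.rep_eq)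

lemma mps_nth_sum [simp]: "mps_nth (sum f A) m = (\<Sum>x\<in>A. mps_nth (f x) m)"
  by (induction A rule: infinite_finite_induct) simp_all

lemma mps_nth_monom_times:
  "mps_nth (mps_monom p c * g) m = (if p \<subseteq># m then c * mps_nth g (m - p) else 0)"
proof -
  have "mps_nth (mps_monom p c * g) m =
      (\<Sum>(u, v)\<in>msplits m. if (u, v) = (p, m - p) then c * mps_nth g (m - p) else 0)"
    unfolding mps_nth_simps mps_monom.rep_eq
    by (rule sum.cong) (auto simp: msplits_def)
  also have "\<dots> = (\<Sum>x\<in>msplits m. if (p, m - p) = x then c * mps_nth g (m - p) else 0)"
    by (rule sum.cong) (auto split: prod.splits)
  also have "\<dots> = (if p \<subseteq># m then c * mps_nth g (m - p) else 0)"
    by (subst sum.delta')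
      (auto simp: msplits_def[of m] intro: finite_msplits[unfolded msplits_def] mset_subset_eqI,
        metis mset_subset_eq_add_left)
  finally show ?thesis .
qed

lemma mps_monom_mult: "mps_monom p c * mps_monom q d = mps_monom (p + q) (c * d)"
proof (rule mps_eqI)
  show "mps_nth (mps_monom p c * mps_monom q d) m = mps_nth (mps_monom (p + q) (c * d)) m" for m
    unfolding mps_nth_monom_times
    by (auto simp: mps_monom.rep_eq subset_mset.add_diff_inverse)
qed

lemma mps_monom_add: "mps_monom p c + mps_monom p d = mps_monom p (c + d)"
  by (rule mps_eqI) (simp add: mps_monom.rep_eq)

lemma mps_monom_sum: "mps_monom p (sum c A) = (\<Sum>x\<in>A. mps_monom p (c x))"
  by (rule mps_eqI) (simp add: mps_monom.rep_eq)

lemma mps_monom_one: "mps_monom {#} 1 = 1"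
  by (rule mps_eqI) (simp add: mps_monom.rep_eq)

lemma xy_mult: "xy a b * xy c d = xy (a + c) (b + d)"
  by (simp add: xy_def mps_monom_mult mult_single)

lemma xy_zero [simp]: "xy 0 0 = 1"
  using mps_monom_one single_one by (metis xy_def zero_prod_def)

lemma xy_power: "xy a b ^ n = xy (int n * a) (int n * b)"
  by (induction n) (simp_all add: xy_mult algebra_simps)

lemma of_R_monom: "of_R (mps_monom m c) = mps_monom m (Poly_Mapping.single 0 c)"
  by (rule mps_eqI) (simp add: of_R.rep_eq mps_monom.rep_eq)

lemma msplits_size: "(p, q) \<in> msplits m \<Longrightarrow> size p + size q = size m"
  by (auto simp: msplits_def)


section \<open>The filtrations by degree\<close>

text \<open>
  The grading by \<open>a - b\<close> modulo \<open>\<mm>\<^sup>n\<close>. The sign \<open>e\<close> allows one to treat the behaviour at \<open>x = 0\<close>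
  (degrees at least \<open>d\<close>, for \<open>e = 1\<close>) and at \<open>x = \<infinity>\<close> (degrees at most \<open>- d\<close>, for \<open>e = -1\<close>) together. The
  truncation is built in because the ordered product is only known modulo powers of \<open>\<mm>\<close>.
\<close>

definition filt :: "int \<Rightarrow> int \<Rightarrow> nat \<Rightarrow> ('k, 'l) B set" where
  "filt e d n = {g. \<forall>m. size m < n \<longrightarrow>
     (\<forall>(a, b)\<in>Poly_Mapping.keys (mps_nth g m). d \<le> e * (a - b))}"

lemma keys_mps_mult:
  fixes g h :: "('k, 'l) B"
  assumes "v \<in> Poly_Mapping.keys (mps_nth (g * h) m)"
  obtains p q v1 v2 where "p + q = m" "v = v1 + v2" "v1 \<in> Poly_Mapping.keys (mps_nth g p)"
    "v2 \<in> Poly_Mapping.keys (mps_nth h q)"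
proof -
  have "v \<in> Poly_Mapping.keys (\<Sum>x\<in>msplits m. mps_nth g (fst x) * mps_nth h (snd x))"
    using assms by (simp add: case_prod_unfold)
  then obtain x where x: "x \<in> msplits m" "v \<in> Poly_Mapping.keys (mps_nth g (fst x) * mps_nth h (snd x))"
    using subsetD[OF keys_sum] by fast
  then obtain v1 v2 where "v = v1 + v2" "v1 \<in> Poly_Mapping.keys (mps_nth g (fst x))"
      "v2 \<in> Poly_Mapping.keys (mps_nth h (snd x))"
    using subsetD[OF keys_mult x(2)] by blast
  then show ?thesis using x(1) by (intro that[of "fst x" "snd x" v1 v2]) (auto simp: msplits_def)
qed

lemma keys_mps_add:
  fixes g h :: "('k, 'l) B"
  shows "Poly_Mapping.keys (mps_nth (g + h) m) \<subseteq>
    Poly_Mapping.keys (mps_nth g m) \<union> Poly_Mapping.keys (mps_nth h m)"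
  by (simp add: keys_add)

lemma keys_mps_diff:
  fixes g h :: "('k, 'l) B"
  shows "Poly_Mapping.keys (mps_nth (g - h) m) \<subseteq>
    Poly_Mapping.keys (mps_nth g m) \<union> Poly_Mapping.keys (mps_nth h m)"
  by (simp add: keys_diff)

lemma filt_zero [simp]: "0 \<in> filt e d n"
  by (simp add: filt_def)

lemma filt_add: "g \<in> filt e d n \<Longrightarrow> h \<in> filt e d n \<Longrightarrow> g + h \<in> filt e d n"
  unfolding filt_def using keys_mps_add[of g h] by blast

lemma filt_diff: "g \<in> filt e d n \<Longrightarrow> h \<in> filt e d n \<Longrightarrow> g - h \<in> filt e d n"
  unfolding filt_def using keys_mps_diff[of g h] by blast

lemma filt_mult:
  assumes "g \<in> filt e d n" "h \<in> filt e d' n"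
  shows "g * h \<in> filt e (d + d') n"
  unfolding filt_def
proof (safe)
  fix m a b assume m: "size m < n" and "(a, b) \<in> Poly_Mapping.keys (mps_nth (g * h) m)"
  then obtain p q v1 v2 where *: "p + q = m" "(a, b) = v1 + v2" "v1 \<in> Poly_Mapping.keys (mps_nth g p)"
    "v2 \<in> Poly_Mapping.keys (mps_nth h q)" by (metis keys_mps_mult)
  then have "size p < n" "size q < n" using m by auto
  then have "d \<le> e * (fst v1 - snd v1)" "d' \<le> e * (fst v2 - snd v2)"
    using * assms unfolding filt_def by fastforce+
  moreover have "a = fst v1 + fst v2" "b = snd v1 + snd v2"
    using *(2) by (auto simp: plus_prod_def)
  ultimately show "d + d' \<le> e * (a - b)" by (simp add: algebra_simps)
qed

lemma filt_mono: "d' \<le> d \<Longrightarrow> n' \<le> n \<Longrightarrow> filt e d n \<subseteq> filt e d' n'"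
proof safe
  fix g :: "('a, 'b) B" assume *: "d' \<le> d" "n' \<le> n" "g \<in> filt e d n"
  show "g \<in> filt e d' n'"
    unfolding filt_def
  proof safe
    fix m :: "('a + 'b) multiset" and a b
    assume "size m < n'" and ab: "(a, b) \<in> Poly_Mapping.keys (mps_nth g m)"
    then have "size m < n" using *(2) by linarith
    then have "\<forall>(a, b)\<in>Poly_Mapping.keys (mps_nth g m). d \<le> e * (a - b)"
      using *(3) \<open>size m < n\<close> unfolding filt_def by simp
    with ab have "d \<le> e * (a - b)" by auto
    then show "d' \<le> e * (a - b)" using * by linarith
  qed
qed

lemma filt_mult_left: "g \<in> filt e 0 n \<Longrightarrow> h \<in> filt e d n \<Longrightarrow> g * h \<in> filt e d n"
  using filt_mult[of g e 0 n h d] by simp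

lemma filt_mult_right: "g \<in> filt e d n \<Longrightarrow> h \<in> filt e 0 n \<Longrightarrow> g * h \<in> filt e d n"
  using filt_mult[of g e d n h 0] by simp

lemma filt_monom:
  assumes "\<And>v. v \<in> Poly_Mapping.keys c \<Longrightarrow> d \<le> e * (fst v - snd v)"
  shows "mps_monom m c \<in> filt e d n"
  using assms by (fastforce simp: filt_def mps_monom.rep_eq)

lemma filt_xy: "d \<le> e * (a - b) \<Longrightarrow> xy a b \<in> filt e d n"
  unfolding xy_def by (rule filt_monom) auto

lemma filt_one [simp]: "1 \<in> filt e 0 n"
  using filt_xy[of 0 e 0 0 n] by simp

lemma filt_of_R: "of_R r \<in> filt e 0 n"
  by (auto simp: filt_def of_R.rep_eq zero_prod_def split: if_splits)

lemma svar_eq: "svar k = of_R (mps_monom {#Inl k#} 1)"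
  by (simp add: svar_def of_R_monom)

lemma tvar_eq: "tvar l = of_R (mps_monom {#Inr l#} 1)"
  by (simp add: tvar_def of_R_monom)

lemma filt_svar [simp]: "svar k \<in> filt e 0 n"
  by (simp add: svar_eq filt_of_R)

lemma filt_tvar [simp]: "tvar k \<in> filt e 0 n"
  by (simp add: tvar_eq filt_of_R)

lemma filt_prod: "(\<And>i. i \<in> A \<Longrightarrow> f i \<in> filt e 0 n) \<Longrightarrow> prod f A \<in> filt e 0 n"
  by (induction A rule: infinite_finite_induct) (auto intro: filt_mult_left)

lemma filt_power: "f \<in> filt e 0 n \<Longrightarrow> f ^ i \<in> filt e 0 n"
  by (induction i) (auto intro: filt_mult_left)

lemma filt_prod_cong:
  assumes "\<And>i. i \<in> A \<Longrightarrow> f i - g i \<in> filt e 1 n" "\<And>i. i \<in> A \<Longrightarrow> g i \<in> filt e 0 n"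
  shows "prod f A - prod g A \<in> filt e 1 n"
  using assms
proof (induction A rule: infinite_finite_induct)
  case (insert a A)
  have "f i \<in> filt e 0 n" if "i \<in> A" for i
    using filt_add[of "f i - g i" e 0 n "g i"] insert.prems that filt_mono[of 0 1 n n e]
    by auto
  then have "f a * prod f A - g a * prod g A \<in> filt e 1 n"
    using filt_add[of "(f a - g a) * prod f A" e 1 n "g a * (prod f A - prod g A)"]
      filt_mult_right[of "f a - g a" e 1 n "prod f A"] filt_mult_left[of "g a" e n "prod f A - prod g A" 1]
      filt_prod[of A f e n] insert
    by (simp add: algebra_simps)
  then show ?case using insert by simp
qed auto

lemma max_ideal_power_subset_filt: "max_ideal_power n \<subseteq> filt e d n"
  by (auto simp: max_ideal_power_def filt_def)

text \<open>The uniqueness in the Birkhoff factorization: a difference of degree 0 between a series of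
  positive degrees and one of negative degrees vanishes.\<close>

lemma filt_opposite:
  assumes "g \<in> filt 1 1 n" "h \<in> filt (-1) 1 n" "g - h \<in> filt 1 0 n" "g - h \<in> filt (-1) 0 n"
  shows "g - h \<in> max_ideal_power n"
  unfolding max_ideal_power_def
proof safe
  fix m :: "('a + 'b) multiset" assume m: "size m < n"
  have "v \<notin> Poly_Mapping.keys (mps_nth (g - h) m)" for v
  proof
    assume v: "v \<in> Poly_Mapping.keys (mps_nth (g - h) m)"
    then have "v \<in> Poly_Mapping.keys (mps_nth g m) \<or> v \<in> Poly_Mapping.keys (mps_nth h m)"
      using keys_mps_diff by blast
    then have "1 \<le> fst v - snd v \<or> 1 \<le> - (fst v - snd v)"
      using assms(1,2) m unfolding filt_def by fastforce
    moreover have "0 \<le> fst v - snd v" "0 \<le> - (fst v - snd v)"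
      using assms(3,4) m v unfolding filt_def by fastforce+
    ultimately show False by linarith
  qed
  then show "mps_nth (g - h) m = 0" by (metis ex_in_conv keys_eq_empty)
qed

lemma max_ideal_power_add: "g \<in> max_ideal_power n \<Longrightarrow> h \<in> max_ideal_power n \<Longrightarrow> g + h \<in> max_ideal_power n"
  and max_ideal_power_diff: "g \<in> max_ideal_power n \<Longrightarrow> h \<in> max_ideal_power n \<Longrightarrow> g - h \<in> max_ideal_power n"
  and max_ideal_power_zero [simp]: "0 \<in> max_ideal_power n"
  and max_ideal_power_all [simp]: "g \<in> max_ideal_power 0"
  by (auto simp: max_ideal_power_def)

lemma max_ideal_power_mult:
  assumes "g \<in> max_ideal_power i" "h \<in> max_ideal_power j"
  shows "g * h \<in> max_ideal_power (i + j)"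
  unfolding max_ideal_power_def
proof safe
  fix m :: "('a + 'b) multiset" assume m: "size m < i + j"
  have "mps_nth g p * mps_nth h q = 0" if "(p, q) \<in> msplits m" for p q
  proof -
    have "size p < i \<or> size q < j" using msplits_size[OF that] m by linarith
    then show ?thesis using assms by (auto simp: max_ideal_power_def)
  qed
  then show "mps_nth (g * h) m = 0"
    by (auto intro!: sum.neutral)
qed

lemma max_ideal_power_mult_Suc:
  "g \<in> max_ideal_power 1 \<Longrightarrow> h \<in> max_ideal_power n \<Longrightarrow> g * h \<in> max_ideal_power (Suc n)"
  using max_ideal_power_mult[of g 1 h n] by (simp only: plus_1_eq_Suc)

lemma max_ideal_power_mult_left: "h \<in> max_ideal_power j \<Longrightarrow> g * h \<in> max_ideal_power j"
  using max_ideal_power_mult[of g 0 h j] by simp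

lemma max_ideal_power_mult_right: "h \<in> max_ideal_power j \<Longrightarrow> h * g \<in> max_ideal_power j"
  using max_ideal_power_mult[of h j g 0] by simp

lemma max_ideal_power_sum: "(\<And>i. i \<in> A \<Longrightarrow> f i \<in> max_ideal_power n) \<Longrightarrow> sum f A \<in> max_ideal_power n"
  by (induction A rule: infinite_finite_induct) (auto intro: max_ideal_power_add)

lemma max_ideal_power_prod_cong:
  assumes "\<And>i. i \<in> A \<Longrightarrow> f i - g i \<in> max_ideal_power n"
  shows "prod f A - prod g A \<in> max_ideal_power n"
  using assms
proof (induction A rule: infinite_finite_induct)
  case (insert a A)
  have "(f a - g a) * prod f A + g a * (prod f A - prod g A) \<in> max_ideal_power n"
    using insert by (intro max_ideal_power_add max_ideal_power_mult_right max_ideal_power_mult_left) auto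
  then show ?case using insert.hyps by (simp add: algebra_simps)
qed auto

lemma max_ideal_power_svar [simp]: "svar k \<in> max_ideal_power 1"
  and max_ideal_power_tvar [simp]: "tvar l \<in> max_ideal_power 1"
  by (auto simp: max_ideal_power_def svar_def tvar_def mps_monom.rep_eq)

lemma separated:
  fixes g h :: "('k, 'l) B"
  assumes "\<And>n. g - h \<in> max_ideal_power n"
  shows "g = h"
proof (rule mps_eqI)
  fix m :: "('k + 'l) multiset"
  have "g - h \<in> max_ideal_power (Suc (size m))" by (rule assms)
  then show "mps_nth g m = mps_nth h m"
    unfolding max_ideal_power_def by auto
qed

text \<open>Banach's fixed point theorem for the \<open>\<mm>\<close>-adic topology.\<close>

lemma contraction_fixed_point:
  fixes F :: "('i \<Rightarrow> ('k, 'l) B) \<Rightarrow> 'i \<Rightarrow> ('k, 'l) B"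
  assumes contr: "\<And>D D' n. (\<And>i. D i - D' i \<in> max_ideal_power n) \<Longrightarrow>
    (\<And>i. F D i - F D' i \<in> max_ideal_power (Suc n))"
  obtains D where "\<And>i. D i = F D i"
proof
  define E where "E n = (F ^^ n) (\<lambda>_. 0)" for n
  have ESuc: "E (Suc n) = F (E n)" for n by (simp add: E_def)
  have step: "E (Suc n) i - E n i \<in> max_ideal_power n" for n i
  proof (induction n arbitrary: i)
    case (Suc n)
    show ?case unfolding ESuc[of "Suc n"] ESuc[of n] 
      by (rule contr) (use Suc in \<open>simp add: ESuc\<close>)
  qed simp
  have "E (n + j) i - E n i \<in> max_ideal_power n" for n j i
  proof (induction j)
    case (Suc j)
    have "E (n + Suc j) i - E (n + j) i \<in> max_ideal_power n"
      using step[of "n + j" i] by (auto simp: max_ideal_power_def)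
    from max_ideal_power_add[OF this Suc] show ?case by simp
  qed simp
  then have Cauchy: "E n' i - E n i \<in> max_ideal_power n" if "n \<le> n'" for n n' i
    using that by (metis le_add_diff_inverse)
  define D where "D i = Abs_mps (\<lambda>m. mps_nth (E (Suc (size m)) i) m)" for i
  have D_E: "D i - E n i \<in> max_ideal_power n" for n i
  proof -
    have "mps_nth (E (Suc (size m)) i) m = mps_nth (E n i) m" if "size m < n" for m
      using Cauchy[of "Suc (size m)" n i] that by (auto simp: max_ideal_power_def)
    then show ?thesis
      by (auto simp: max_ideal_power_def D_def Abs_mps_inverse)
  qed
  show "D i = F D i" for i
  proof (rule separated)
    fix n
    have "F D i - E (Suc n) i \<in> max_ideal_power (Suc n)"
      unfolding ESuc by (rule contr) (rule D_E)
    from max_ideal_power_diff[OF D_E[of i "Suc n"] this] have "D i - F D i \<in> max_ideal_power (Suc n)"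
      by simp
    then show "D i - F D i \<in> max_ideal_power n"
      by (auto simp: max_ideal_power_def)
  qed
qed


section \<open>Units\<close>

definition minv :: "'a::comm_ring_1 \<Rightarrow> 'a" where "minv u = (THE v. u * v = 1)"

lemma minv_eq: assumes "u * v = 1" shows "minv u = v"
  unfolding minv_def
proof (rule the_equality)
  fix w assume "u * w = 1"
  then show "w = v" using assms by (metis mult.commute mult.left_commute mult.right_neutral)
qed (rule assms)

lemma unit_powi_of_nat: "unit_powi u (int n) = u ^ n"
  by (simp add: unit_powi_def)

lemma unit_powi_minus_of_nat: assumes "u * v = 1" shows "unit_powi u (- int n) = v ^ n"
  using minv_eq[OF assms] by (auto simp: unit_powi_def minv_def)

lemma unit_powi_add:
  assumes uv: "u * v = 1"
  shows "unit_powi u (i + j) = unit_powi u i * unit_powi u j"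
proof -
  have one: "unit_powi u (i + 1) = unit_powi u i * u" for i
  proof (cases "0 \<le> i")
    case True
    then show ?thesis by (simp add: unit_powi_def nat_add_distrib)
  next
    case False
    then obtain n where i: "i = - int (Suc n)" by (metis int_cases linorder_not_le negD of_nat_0_le_iff)
    have "unit_powi u (i + 1) = v ^ n"
      using unit_powi_minus_of_nat[OF uv, of n] by (simp add: i)
    moreover have "unit_powi u i = v ^ Suc n"
      unfolding i by (rule unit_powi_minus_of_nat[OF uv])
    ultimately show ?thesis using uv by (simp add: mult.commute[of v] mult.assoc)
  qed
  show ?thesis
  proof (induction j rule: int_induct[where k = 0])
    case base
    then show ?case by (simp add: unit_powi_def)
  next
    case (step1 j)
    then show ?case using one[of "i + j"] one[of j] by (simp add: algebra_simps)
  next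
    case (step2 j)
    have "unit_powi u (i + (j - 1)) * u = unit_powi u i * (unit_powi u (j - 1) * u)"
      using one[of "i + (j - 1)"] one[of "j - 1"] step2 by (simp add: algebra_simps)
    then have "unit_powi u (i + (j - 1)) * u * v = unit_powi u i * (unit_powi u (j - 1) * u) * v"
      by simp
    then show ?case using uv by (simp add: mult.assoc)
  qed
qed

lemma one_plus_max_ideal_mult:
  assumes "g - 1 \<in> max_ideal_power 1" "h - 1 \<in> max_ideal_power 1"
  shows "g * h - 1 \<in> max_ideal_power 1"
proof -
  have "g * h - 1 = (g - 1) * h + (h - 1)" by (simp add: algebra_simps)
  then show ?thesis using assms max_ideal_power_add max_ideal_power_mult_right by metis
qed

lemma one_plus_max_ideal_prod:
  "(\<And>i. i \<in> A \<Longrightarrow> f i - 1 \<in> max_ideal_power 1) \<Longrightarrow> prod f A - 1 \<in> max_ideal_power 1"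
  by (induction A rule: infinite_finite_induct) (auto intro: one_plus_max_ideal_mult)

lemma one_plus_max_ideal_inverse:
  fixes f :: "('k, 'l) B"
  assumes f: "f - 1 \<in> max_ideal_power 1"
  shows "f * minv f = 1" "minv f - 1 \<in> max_ideal_power 1"
proof -
  obtain D :: "unit \<Rightarrow> ('k, 'l) B" where D: "\<And>i. D i = 1 - (f - 1) * D i"
  proof (rule contraction_fixed_point[of "\<lambda>D i. 1 - (f - 1) * D i"])
    fix D D' :: "unit \<Rightarrow> ('k, 'l) B" and n i
    assume "\<And>i. D i - D' i \<in> max_ideal_power n"
    then have "D' i - D i \<in> max_ideal_power n"
      using max_ideal_power_diff[of 0 n "D i - D' i"] by fastforce
    from max_ideal_power_mult_Suc[OF f this] show "1 - (f - 1) * D i - (1 - (f - 1) * D' i) \<in> max_ideal_power (Suc n)"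
      by (simp add: algebra_simps)
  qed blast
  have *: "f * D () = 1" using D[of "()"] by (simp add: algebra_simps)
  then show "f * minv f = 1" using minv_eq by metis
  have "D () - 1 = 0 - (f - 1) * D ()" using D[of "()"] by (simp add: algebra_simps)
  then show "minv f - 1 \<in> max_ideal_power 1"
    unfolding minv_eq[OF *] using max_ideal_power_diff[OF max_ideal_power_zero] max_ideal_power_mult_right[OF f] by metis
qed

text \<open>Multiplication by an element of \<open>\<mm>\<close> gains one order of precision; this is what lets one
  bootstrap membership of an implicitly defined series in a filtration step.\<close>

lemma filt_mult_gain:
  assumes g: "g \<in> max_ideal_power 1" "g \<in> filt e d (Suc n)" and h: "h \<in> filt e d' n"
  shows "g * h \<in> filt e (d + d') (Suc n)"
proof -
  define h' where "h' = Abs_mps (\<lambda>m. if size m < n then mps_nth h m else 0)"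
  have h': "mps_nth h' m = (if size m < n then mps_nth h m else 0)" for m
    by (simp add: h'_def Abs_mps_inverse)
  have "h - h' \<in> max_ideal_power n" by (simp add: max_ideal_power_def h')
  with g(1) have "g * (h - h') \<in> max_ideal_power (Suc n)"
    by (rule max_ideal_power_mult_Suc)
  then have 1: "g * (h - h') \<in> filt e (d + d') (Suc n)"
    using max_ideal_power_subset_filt by blast
  have "h' \<in> filt e d' (Suc n)" using h by (simp add: filt_def h')
  from filt_add[OF 1 filt_mult[OF g(2) this]] show ?thesis by (simp add: algebra_simps)
qed

lemma filt_minv:
  assumes f: "f - 1 \<in> max_ideal_power 1" "f \<in> filt e 0 n"
  shows "minv f \<in> filt e 0 n"
proof -
  have fix_eq: "minv f = 1 - (f - 1) * minv f"
    using one_plus_max_ideal_inverse(1)[OF f(1)] by (simp add: algebra_simps)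
  have "j \<le> n \<Longrightarrow> minv f \<in> filt e 0 j" for j
  proof (induction j)
    case 0
    then show ?case by (simp add: filt_def)
  next
    case (Suc j)
    have "f - 1 \<in> filt e 0 (Suc j)"
      using filt_mono[of 0 0 "Suc j" n e] Suc.prems f(2) by (auto intro: filt_diff)
    from filt_diff[OF filt_one filt_mult_gain[OF f(1) this, of "minv f" 0, simplified]]
    show ?case using Suc by (subst fix_eq) auto
  qed
  then show ?thesis by simp
qed

lemma filt_minv_cong:
  assumes f: "f - 1 \<in> max_ideal_power 1" and g: "g - 1 \<in> max_ideal_power 1"
    and "g \<in> filt e 0 n" "f - g \<in> filt e 1 n"
  shows "minv f - minv g \<in> filt e 1 n"
proof -
  have "f \<in> filt e 0 n"
    using filt_add[of "f - g" e 0 n g] assms filt_mono[of 0 1 n n e] by auto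
  have "(minv f * (f - g)) * minv g \<in> filt e 1 n"
    by (intro filt_mult_right filt_mult_left filt_minv assms \<open>f \<in> filt e 0 n\<close>)
  then have "0 - (minv f * (f - g)) * minv g \<in> filt e 1 n"
    by (intro filt_diff) auto
  moreover have "0 - (minv f * (f - g)) * minv g = minv f * (g * minv g) - (f * minv f) * minv g"
    by (simp add: algebra_simps)
  ultimately show ?thesis
    by (simp add: one_plus_max_ideal_inverse[OF f] one_plus_max_ideal_inverse[OF g])
qed


section \<open>Linear maps over \<open>R\<close>\<close>

definition R_linear :: "(('k, 'l) B \<Rightarrow> ('k, 'l) B) \<Rightarrow> bool" where
  "R_linear \<delta> \<longleftrightarrow> (\<forall>g h. \<delta> (g + h) = \<delta> g + \<delta> h) \<and> (\<forall>r g. \<delta> (of_R r * g) = of_R r * \<delta> g)"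

lemma R_linear_add: "R_linear \<delta> \<Longrightarrow> \<delta> (g + h) = \<delta> g + \<delta> h"
  and R_linear_scale: "R_linear \<delta> \<Longrightarrow> \<delta> (of_R r * g) = of_R r * \<delta> g"
  by (auto simp: R_linear_def)

lemma R_linear_zero: "R_linear \<delta> \<Longrightarrow> \<delta> 0 = 0"
  using R_linear_add[of \<delta> 0 0] by simp

lemma R_linear_diff: "R_linear \<delta> \<Longrightarrow> \<delta> (g - h) = \<delta> g - \<delta> h"
  using R_linear_add[of \<delta> "g - h" h] by (simp add: algebra_simps)

lemma R_linear_sum: "R_linear \<delta> \<Longrightarrow> \<delta> (sum f A) = (\<Sum>i\<in>A. \<delta> (f i))"
  by (induction A rule: infinite_finite_induct) (simp_all add: R_linear_zero R_linear_add)

text \<open>Choose for every monomial of degree at least \<open>n\<close> a divisor of degree \<open>n\<close>. Collecting the terms of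
  \<open>g\<close> with the same divisor writes \<open>g\<close> as a combination of monomials of degree \<open>n\<close>; as there are
  only finitely many of these, linearity applies.\<close>

lemma R_linear_continuous:
  fixes \<delta> :: "('k::finite, 'l::finite) B \<Rightarrow> ('k, 'l) B"
  assumes \<delta>: "R_linear \<delta>" and g: "g \<in> max_ideal_power n"
  shows "\<delta> g \<in> max_ideal_power n"
proof -
  define M :: "('k + 'l) multiset set" where "M = multisets_of_size UNIV n"
  have [simp]: "finite M" by (simp add: M_def finite_multisets_of_size)
  have "\<exists>u. u \<subseteq># m \<and> size u = n" if "n \<le> size m" for m :: "('k + 'l) multiset"
  proof -
    obtain xs where "m = mset xs" by (metis ex_mset)
    then have "mset (take n xs) \<subseteq># m \<and> size (mset (take n xs)) = n"
      using that mset_subset_eq_add_left[of "mset (take n xs)" "mset (drop n xs)"]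
      by (simp flip: mset_append)
    then show ?thesis by blast
  qed
  then have ex: "\<exists>u. u \<subseteq># m \<and> size u = n" if "n \<le> size m" for m :: "('k + 'l) multiset"
    using that by blast
  define c where "c m = (SOME u. u \<subseteq># m \<and> size u = n)" for m :: "('k + 'l) multiset"
  have c: "c m \<subseteq># m \<and> size (c m) = n" if "n \<le> size m" for m
    unfolding c_def by (rule someI_ex[OF ex[OF that]])
  define G where "G u = Abs_mps (\<lambda>q. if c (u + q) = u then mps_nth g (u + q) else 0)" for u
  have G: "mps_nth (G u) q = (if c (u + q) = u then mps_nth g (u + q) else 0)" for u q
    by (simp add: G_def Abs_mps_inverse)
  have "g = (\<Sum>u\<in>M. mps_monom u 1 * G u)"
  proof (rule mps_eqI)
    fix m
    have "mps_nth (\<Sum>u\<in>M. mps_monom u 1 * G u) m =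
        (\<Sum>u\<in>M. if u = c m \<and> u \<subseteq># m then mps_nth g m else 0)"
      unfolding mps_nth_sum mps_nth_monom_times G
      by (rule sum.cong) (auto simp: subset_mset.add_diff_inverse)
    also have "\<dots> = mps_nth g m"
    proof (cases "n \<le> size m")
      case True
      have "(\<Sum>u\<in>M. if u = c m \<and> u \<subseteq># m then mps_nth g m else 0) =
          (\<Sum>u\<in>M. if u = c m then mps_nth g m else 0)"
        using c[OF True] by (intro sum.cong) auto
      moreover have "c m \<in> M" using c[OF True] by (simp add: M_def multisets_of_size_def)
      ultimately show ?thesis by simp
    next
      case False
      then have "mps_nth g m = 0" using g by (simp add: max_ideal_power_def)
      then show ?thesis by (auto intro!: sum.neutral)
    qed
    finally show "mps_nth g m = mps_nth (\<Sum>u\<in>M. mps_monom u 1 * G u) m" by simp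
  qed
  also have "\<dots> = (\<Sum>u\<in>M. of_R (mps_monom u 1) * G u)"
    by (simp add: of_R_monom)
  finally have "\<delta> g = (\<Sum>u\<in>M. of_R (mps_monom u 1) * \<delta> (G u))"
    by (metis (no_types, lifting) R_linear_scale R_linear_sum \<delta> sum.cong)
  moreover have "(of_R (mps_monom u 1) :: ('k, 'l) B) \<in> max_ideal_power n" if "u \<in> M" for u
    using that by (auto simp: M_def multisets_of_size_def max_ideal_power_def of_R.rep_eq mps_monom.rep_eq)
  ultimately show ?thesis
    by (auto intro!: max_ideal_power_sum max_ideal_power_mult_right)
qed

lemma laurent_monomials: "(c :: laurent) = (\<Sum>v\<in>Poly_Mapping.keys c. Poly_Mapping.single v (Poly_Mapping.lookup c v))"
proof (rule poly_mapping_eqI)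
  fix v
  have "Poly_Mapping.lookup (\<Sum>u\<in>Poly_Mapping.keys c. Poly_Mapping.single u (Poly_Mapping.lookup c u)) v =
      (\<Sum>u\<in>Poly_Mapping.keys c. if u = v then Poly_Mapping.lookup c v else 0)"
    unfolding lookup_sum by (rule sum.cong) (simp_all add: lookup_single when_def)
  then show "Poly_Mapping.lookup c v = Poly_Mapping.lookup (\<Sum>u\<in>Poly_Mapping.keys c. Poly_Mapping.single u (Poly_Mapping.lookup c u)) v"
    by (simp add: in_keys_iff)
qed

text \<open>By continuity, statements about the image of a series modulo \<open>\<mm>\<^sup>n\<close> reduce to the finitely many
  Laurent monomials that occur in its terms of degree less than \<open>n\<close>.\<close>

lemma R_linear_mem:
  fixes \<delta> :: "('k::finite, 'l::finite) B \<Rightarrow> ('k, 'l) B"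
  assumes \<delta>: "R_linear \<delta>"
    and I: "max_ideal_power n \<subseteq> I" "\<And>g h. g \<in> I \<Longrightarrow> h \<in> I \<Longrightarrow> g + h \<in> I" "\<And>r g. g \<in> I \<Longrightarrow> of_R r * g \<in> I"
    and g: "\<And>m a b. size m < n \<Longrightarrow> (a, b) \<in> Poly_Mapping.keys (mps_nth g m) \<Longrightarrow> \<delta> (xy a b) \<in> I"
  shows "\<delta> g \<in> I"
proof -
  define M :: "('k + 'l) multiset set" where "M = (\<Union>i<n. multisets_of_size UNIV i)"
  have M: "m \<in> M \<longleftrightarrow> size m < n" for m
    by (auto simp: M_def multisets_of_size_def)
  have [simp]: "finite M"
    unfolding M_def by (intro finite_UN_I finite_multisets_of_size) auto
  have I_sum: "sum f A \<in> I" if "\<And>i. i \<in> A \<Longrightarrow> f i \<in> I" for f and A :: "'i set"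
    using that I(1,2) max_ideal_power_zero[of n] 
    by (induction A rule: infinite_finite_induct) auto
  have "mps_nth (\<Sum>m\<in>M. mps_monom m (mps_nth g m)) m = mps_nth g m" if "size m < n" for m
    using that M by (simp add: mps_monom.rep_eq)
  then have "g - (\<Sum>m\<in>M. mps_monom m (mps_nth g m)) \<in> max_ideal_power n"
    by (simp add: max_ideal_power_def)
  from R_linear_continuous[OF \<delta> this] have 1: "\<delta> g - \<delta> (\<Sum>m\<in>M. mps_monom m (mps_nth g m)) \<in> I"
    using I(1) by (auto simp: R_linear_diff[OF \<delta>])
  have "mps_monom m (mps_nth g m) =
      (\<Sum>v\<in>Poly_Mapping.keys (mps_nth g m). of_R (mps_monom m (Poly_Mapping.lookup (mps_nth g m) v)) * xy (fst v) (snd v))" for m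
    by (subst laurent_monomials[of "mps_nth g m"])
      (simp add: mps_monom_sum of_R_monom xy_def mps_monom_mult mult_single)
  then have "\<delta> (\<Sum>m\<in>M. mps_monom m (mps_nth g m)) =
     (\<Sum>m\<in>M. \<Sum>v\<in>Poly_Mapping.keys (mps_nth g m). of_R (mps_monom m (Poly_Mapping.lookup (mps_nth g m) v)) * \<delta> (xy (fst v) (snd v)))"
    by (simp add: R_linear_sum[OF \<delta>] R_linear_scale[OF \<delta>])
  also have "\<dots> \<in> I"
    by (intro I_sum I(3) g) (auto simp: M)
  finally have "\<delta> (\<Sum>m\<in>M. mps_monom m (mps_nth g m)) \<in> I" .
  from I(2)[OF 1 this] show ?thesis by simp
qed

definition R_hom :: "(('k, 'l) B \<Rightarrow> ('k, 'l) B) \<Rightarrow> bool" where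
  "R_hom \<phi> \<longleftrightarrow> R_linear \<phi> \<and> \<phi> 1 = 1 \<and> (\<forall>g h. \<phi> (g * h) = \<phi> g * \<phi> h)"

lemma R_hom_linear: "R_hom \<phi> \<Longrightarrow> R_linear \<phi>"
  and R_hom_one: "R_hom \<phi> \<Longrightarrow> \<phi> 1 = 1"
  and R_hom_mult: "R_hom \<phi> \<Longrightarrow> \<phi> (g * h) = \<phi> g * \<phi> h"
  and R_hom_add: "R_hom \<phi> \<Longrightarrow> \<phi> (g + h) = \<phi> g + \<phi> h"
  by (auto simp: R_hom_def R_linear_def)

lemma R_hom_of_R: "R_hom \<phi> \<Longrightarrow> \<phi> (of_R r) = of_R r"
  using R_linear_scale[of \<phi> r 1] by (simp add: R_hom_def)

lemma R_hom_svar: "R_hom \<phi> \<Longrightarrow> \<phi> (svar k) = svar k"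
  and R_hom_tvar: "R_hom \<phi> \<Longrightarrow> \<phi> (tvar l) = tvar l"
  by (simp_all add: svar_eq tvar_eq R_hom_of_R)

lemma R_hom_prod: "R_hom \<phi> \<Longrightarrow> \<phi> (prod f A) = (\<Prod>i\<in>A. \<phi> (f i))"
  by (induction A rule: infinite_finite_induct) (simp_all add: R_hom_one R_hom_mult)

lemma R_hom_power: "R_hom \<phi> \<Longrightarrow> \<phi> (g ^ i) = \<phi> g ^ i"
  by (induction i) (simp_all add: R_hom_one R_hom_mult)

lemma R_hom_scale: "R_hom \<phi> \<Longrightarrow> \<phi> (of_R r * g) = of_R r * \<phi> g"
  by (simp add: R_hom_linear R_linear_scale)

lemma R_hom_comp: "R_hom \<phi> \<Longrightarrow> R_hom \<psi> \<Longrightarrow> R_hom (\<phi> \<circ> \<psi>)"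
  unfolding R_hom_def[of "\<phi> \<circ> \<psi>"] R_linear_def
  by (simp add: R_hom_one R_hom_add) (simp add: R_hom_mult R_hom_of_R)

lemma R_hom_id: "R_hom id"
  by (simp add: R_hom_def R_linear_def)

lemma R_linear_hom_diff: "R_hom \<phi> \<Longrightarrow> R_hom \<psi> \<Longrightarrow> R_linear (\<lambda>g. \<phi> g - \<psi> g)"
  unfolding R_linear_def by (simp add: R_hom_scale R_hom_add right_diff_distrib)

lemma R_hom_xy_nat:
  assumes "R_hom \<phi>"
  shows "\<phi> (xy (int i) (int j)) = \<phi> (xy 1 0) ^ i * \<phi> (xy 0 1) ^ j"
proof -
  have "xy (int i) (int j) = xy 1 0 ^ i * xy 0 1 ^ j" by (simp add: xy_power xy_mult)
  then show ?thesis using assms by (metis R_hom_mult R_hom_power)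
qed

lemma R_hom_eqI:
  fixes \<phi> \<psi> :: "('k::finite, 'l::finite) B \<Rightarrow> ('k, 'l) B"
  assumes \<phi>: "R_hom \<phi>" and \<psi>: "R_hom \<psi>" and "\<phi> (xy 1 0) = \<psi> (xy 1 0)" "\<phi> (xy 0 1) = \<psi> (xy 0 1)"
  shows "\<phi> = \<psi>"
proof
  fix g
  have nat: "\<phi> (xy (int i) (int j)) = \<psi> (xy (int i) (int j))" for i j
    using assms by (simp add: R_hom_xy_nat)
  have xy: "\<phi> (xy a b) = \<psi> (xy a b)" for a b
  proof -
    define N :: "('k, 'l) B" where "N = xy (int (nat (- a))) (int (nat (- b)))"
    define N' :: "('k, 'l) B" where "N' = xy (- int (nat (- a))) (- int (nat (- b)))"
    have "N * N' = (1 :: ('k, 'l) B)" by (simp add: N_def N'_def xy_mult)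
    then have unit: "\<psi> N * \<psi> N' = 1"
      using R_hom_mult[OF \<psi>, of N N'] by (simp add: R_hom_one[OF \<psi>])
    have "xy a b * N = xy (int (nat a)) (int (nat b))" unfolding N_def xy_mult by simp
    then have "\<phi> (xy a b) * \<phi> N = \<psi> (xy a b) * \<psi> N"
      using nat by (metis R_hom_mult \<phi> \<psi>)
    moreover have "\<phi> N = \<psi> N" unfolding N_def by (rule nat)
    ultimately have "\<phi> (xy a b) * \<psi> N * \<psi> N' = \<psi> (xy a b) * \<psi> N * \<psi> N'" by simp
    then show ?thesis using unit by (simp add: mult.assoc)
  qed
  show "\<phi> g = \<psi> g"
  proof (rule separated)
    fix n
    show "\<phi> g - \<psi> g \<in> max_ideal_power n"
      by (rule R_linear_mem[OF R_linear_hom_diff[OF \<phi> \<psi>], of n])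
        (auto intro: max_ideal_power_add max_ideal_power_mult_left simp: xy)
  qed
qed


section \<open>Substitution homomorphisms\<close>

definition laurent_subst :: "(int \<times> int \<Rightarrow> ('k, 'l) B) \<Rightarrow> laurent \<Rightarrow> ('k, 'l) B" where
  "laurent_subst \<chi> c = (\<Sum>v\<in>Poly_Mapping.keys c. of_R (mps_monom {#} (Poly_Mapping.lookup c v)) * \<chi> v)"

lemma of_R_one [simp]: "of_R 1 = 1"
  by (rule mps_eqI) (simp add: of_R.rep_eq)

lemma of_R_monom_zero [simp]: "of_R (mps_monom m 0) = 0"
  by (rule mps_eqI) (simp add: of_R_monom mps_monom.rep_eq)

lemma of_R_monom_add: "of_R (mps_monom m (c + d)) = of_R (mps_monom m c) + of_R (mps_monom m d)"
  by (simp add: of_R_monom mps_monom_add single_add)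

lemma laurent_subst_superset:
  assumes "finite S" "Poly_Mapping.keys c \<subseteq> S"
  shows "laurent_subst \<chi> c = (\<Sum>v\<in>S. of_R (mps_monom {#} (Poly_Mapping.lookup c v)) * \<chi> v)"
  unfolding laurent_subst_def using assms
  by (intro sum.mono_neutral_left) (auto simp: in_keys_iff)

lemma laurent_subst_zero [simp]: "laurent_subst \<chi> 0 = 0"
  by (simp add: laurent_subst_def)

lemma laurent_subst_single: "laurent_subst \<chi> (Poly_Mapping.single v c) = of_R (mps_monom {#} c) * \<chi> v"
  by (subst laurent_subst_superset[of "{v}"]) auto

lemma laurent_subst_add: "laurent_subst \<chi> (c + d) = laurent_subst \<chi> c + laurent_subst \<chi> d"
  using keys_add[of c d]
  by (simp add: laurent_subst_superset[of "Poly_Mapping.keys c \<union> Poly_Mapping.keys d"] lookup_add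
      of_R_monom_add algebra_simps sum.distrib)

lemma laurent_subst_sum: "laurent_subst \<chi> (sum f A) = (\<Sum>i\<in>A. laurent_subst \<chi> (f i))"
  by (induction A rule: infinite_finite_induct) (simp_all add: laurent_subst_add)

lemma laurent_subst_mult:
  fixes \<chi> :: "int \<times> int \<Rightarrow> ('k, 'l) B"
  assumes \<chi>: "\<And>u v. \<chi> (u + v) = \<chi> u * \<chi> v"
  shows "laurent_subst \<chi> (c * d) = laurent_subst \<chi> c * laurent_subst \<chi> d"
proof -
  have "c * d = (\<Sum>u\<in>Poly_Mapping.keys c. \<Sum>v\<in>Poly_Mapping.keys d.
      Poly_Mapping.single (u + v) (Poly_Mapping.lookup c u * Poly_Mapping.lookup d v))"
    by (subst laurent_monomials[of c], subst laurent_monomials[of d])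
      (simp add: sum_product mult_single)
  then have "laurent_subst \<chi> (c * d) = (\<Sum>u\<in>Poly_Mapping.keys c. \<Sum>v\<in>Poly_Mapping.keys d.
      of_R (mps_monom {#} (Poly_Mapping.lookup c u * Poly_Mapping.lookup d v)) * \<chi> (u + v))"
    by (simp add: laurent_subst_sum laurent_subst_single)
  also have "\<dots> = (\<Sum>u\<in>Poly_Mapping.keys c. \<Sum>v\<in>Poly_Mapping.keys d.
      (of_R (mps_monom {#} (Poly_Mapping.lookup c u)) * \<chi> u) * (of_R (mps_monom {#} (Poly_Mapping.lookup d v)) * \<chi> v))"
  proof (intro sum.cong refl)
    fix u v
    have "of_R (mps_monom {#} (Poly_Mapping.lookup c u * Poly_Mapping.lookup d v)) =
        of_R (mps_monom {#} (Poly_Mapping.lookup c u)) * (of_R (mps_monom {#} (Poly_Mapping.lookup d v)) :: ('k, 'l) B)"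
      by (simp add: of_R_monom mps_monom_mult mult_single)
    then show "of_R (mps_monom {#} (Poly_Mapping.lookup c u * Poly_Mapping.lookup d v)) * \<chi> (u + v) =
      (of_R (mps_monom {#} (Poly_Mapping.lookup c u)) * \<chi> u) * (of_R (mps_monom {#} (Poly_Mapping.lookup d v)) * \<chi> v)"
      by (simp add: \<chi> mult_ac)
  qed
  finally show ?thesis by (simp add: laurent_subst_def sum_product)
qed

text \<open>The coefficients of \<open>g\<close> are mapped by \<open>laurent_subst \<chi>\<close>, which yields a power series for each
  monomial of \<open>g\<close>; in the sum of all of them, only divisors of \<open>m\<close> contribute to the coefficient at \<open>m\<close>.\<close>

definition subst :: "(int \<times> int \<Rightarrow> ('k, 'l) B) \<Rightarrow> ('k, 'l) B \<Rightarrow> ('k, 'l) B" where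
  "subst \<chi> g = Abs_mps (\<lambda>m. \<Sum>(p, q)\<in>msplits m. mps_nth (laurent_subst \<chi> (mps_nth g p)) q)"

lemma mps_nth_subst: "mps_nth (subst \<chi> g) m = (\<Sum>(p, q)\<in>msplits m. mps_nth (laurent_subst \<chi> (mps_nth g p)) q)"
  by (simp add: subst_def Abs_mps_inverse)

lemma subst_add: "subst \<chi> (g + h) = subst \<chi> g + subst \<chi> h"
  by (rule mps_eqI) (simp add: mps_nth_subst laurent_subst_add case_prod_unfold sum.distrib)

lemma subst_const:
  "subst \<chi> (mps_monom {#} c) = laurent_subst \<chi> c"
proof (rule mps_eqI)
  fix m
  have "mps_nth (subst \<chi> (mps_monom {#} c)) m =
      (\<Sum>x\<in>msplits m. if x = ({#}, m) then mps_nth (laurent_subst \<chi> c) m else 0)"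
    unfolding mps_nth_subst by (rule sum.cong) (auto simp: msplits_def mps_monom.rep_eq split: if_splits)
  also have "\<dots> = mps_nth (laurent_subst \<chi> c) m"
    by (subst sum.delta) (auto simp: msplits_def[of m] intro: finite_msplits[unfolded msplits_def])
  finally show "mps_nth (subst \<chi> (mps_monom {#} c)) m = mps_nth (laurent_subst \<chi> c) m" .
qed

lemma subst_mult:
  fixes \<chi> :: "int \<times> int \<Rightarrow> ('k, 'l) B"
  assumes \<chi>: "\<And>u v. \<chi> (u + v) = \<chi> u * \<chi> v"
  shows "subst \<chi> (g * h) = subst \<chi> g * subst \<chi> h"
proof (rule mps_eqI)
  fix m
  define L where "L g p q = mps_nth (laurent_subst \<chi> (mps_nth g p)) q" for g :: "('k, 'l) B" and p q
  have "mps_nth (subst \<chi> (g * h)) m = (\<Sum>x\<in>msplits m. \<Sum>y\<in>msplits (fst x). \<Sum>z\<in>msplits (snd x).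
      L g (fst y) (fst z) * L h (snd y) (snd z))"
    by (simp add: mps_nth_subst L_def case_prod_unfold laurent_subst_sum laurent_subst_mult[OF \<chi>])
  also have "\<dots> = (\<Sum>(x, y, z)\<in>(SIGMA x:msplits m. msplits (fst x) \<times> msplits (snd x)).
      L g (fst y) (fst z) * L h (snd y) (snd z))"
    by (subst sum.Sigma[symmetric]) (auto simp: sum.cartesian_product case_prod_unfold)
  also have "\<dots> = (\<Sum>(x, y, z)\<in>(SIGMA x:msplits m. msplits (fst x) \<times> msplits (snd x)).
      L g (fst y) (snd y) * L h (fst z) (snd z))"
    by (rule sum.reindex_bij_witness
          [of _ "\<lambda>(x, y, z). ((fst y + fst z, snd y + snd z), (fst y, fst z), (snd y, snd z))"
                "\<lambda>(x, y, z). ((fst y + fst z, snd y + snd z), (fst y, fst z), (snd y, snd z))"])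
       (auto simp: msplits_def add_ac)
  also have "\<dots> = (\<Sum>x\<in>msplits m. \<Sum>y\<in>msplits (fst x). \<Sum>z\<in>msplits (snd x).
      L g (fst y) (snd y) * L h (fst z) (snd z))"
    by (subst sum.Sigma[symmetric]) (auto simp: sum.cartesian_product case_prod_unfold)
  also have "\<dots> = mps_nth (subst \<chi> g * subst \<chi> h) m"
    by (simp add: mps_nth_subst L_def case_prod_unfold sum_product)
  finally show "mps_nth (subst \<chi> (g * h)) m = mps_nth (subst \<chi> g * subst \<chi> h) m" .
qed

lemma R_hom_subst:
  assumes \<chi>: "\<And>u v. \<chi> (u + v) = \<chi> u * \<chi> v" and \<chi>0: "\<chi> 0 = 1"
  shows "R_hom (subst \<chi>)"
proof -
  have of_R: "subst \<chi> (of_R r) = of_R r" for r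
  proof (rule mps_eqI)
    fix m
    have "mps_nth (subst \<chi> (of_R r)) m =
      (\<Sum>x\<in>msplits m. if x = (m, {#}) then mps_nth (of_R r) m else 0)"
      unfolding mps_nth_subst of_R.rep_eq
      by (rule sum.cong) (auto simp: msplits_def \<chi>0 laurent_subst_single of_R_monom mps_monom.rep_eq split: if_splits)
    also have "\<dots> = mps_nth (of_R r) m"
      by (subst sum.delta) (auto simp: msplits_def[of m] intro: finite_msplits[unfolded msplits_def])
    finally show "mps_nth (subst \<chi> (of_R r)) m = mps_nth (of_R r) m" .
  qed
  have "subst \<chi> 1 = 1"
    using subst_const[of \<chi> 1] laurent_subst_single[of \<chi> 0 1]
    by (simp add: mps_monom_one \<chi>0 of_R_monom)
  then show ?thesis
    by (simp add: R_hom_def R_linear_def subst_add subst_mult[OF \<chi>] of_R)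
qed

lemma subst_xy:
  assumes "\<And>u v. \<chi> (u + v) = \<chi> u * \<chi> v" "\<chi> 0 = 1"
  shows "subst \<chi> (xy a b) = \<chi> (a, b)"
  by (simp add: xy_def subst_const laurent_subst_single of_R_monom) (simp add: mps_monom_one)

lemma R_hom_exists:
  fixes p q :: "('k, 'l) B"
  assumes p: "p * p' = 1" and q: "q * q' = 1"
  obtains \<phi> where "R_hom \<phi>" "\<phi> (xy 1 0) = p" "\<phi> (xy 0 1) = q"
proof
  define \<chi> where "\<chi> v = unit_powi p (fst v) * unit_powi q (snd v)" for v :: "int \<times> int"
  have \<chi>: "\<chi> (u + v) = \<chi> u * \<chi> v" "\<chi> 0 = 1" for u v
    by (simp_all add: \<chi>_def unit_powi_add[OF p] unit_powi_add[OF q])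
      (simp add: unit_powi_def)
  show "R_hom (subst \<chi>)" by (rule R_hom_subst) (simp_all add: \<chi>)
  have "subst \<chi> (xy 1 0) = \<chi> (1, 0)" "subst \<chi> (xy 0 1) = \<chi> (0, 1)"
    by (intro subst_xy; simp add: \<chi>)+
  then show "subst \<chi> (xy 1 0) = p" "subst \<chi> (xy 0 1) = q"
    by (simp_all add: \<chi>_def unit_powi_def)
qed


section \<open>The automorphisms \<open>T\<close>\<close>

lemma R_hom_of_aut: "R_algebra_aut \<phi> \<Longrightarrow> R_hom \<phi>"
  unfolding R_algebra_aut_def R_hom_def R_linear_def by blast

lemma R_algebra_autI: "R_hom \<phi> \<Longrightarrow> bij \<phi> \<Longrightarrow> R_algebra_aut \<phi>"
  unfolding R_algebra_aut_def R_hom_def R_linear_def by blast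

text \<open>In contrast to \<open>vertex_series\<close>, constant terms in \<open>\<mm>\<close> are admitted, which makes this set visibly
  closed under multiplication; \<open>T\<close> is already well-defined on it.\<close>

definition ray_series :: "int \<Rightarrow> int \<Rightarrow> ('k, 'l) B set" where
  "ray_series a b = {f. f - 1 \<in> max_ideal_power 1 \<and>
     (\<forall>m. Poly_Mapping.keys (mps_nth f m) \<subseteq> range (\<lambda>j. (int j * a, int j * b)))}"

lemma vertex_series_subset_ray_series: "vertex_series a b \<subseteq> ray_series a b"
proof
  fix f :: "('a, 'b) B" assume f: "f \<in> vertex_series a b"
  have "Poly_Mapping.keys (mps_nth f m) \<subseteq> range (\<lambda>j. (int j * a, int j * b))" for m
  proof
    fix v assume v: "v \<in> Poly_Mapping.keys (mps_nth f m)"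
    have "f = (f - 1) + 1" by simp
    then have "v \<in> Poly_Mapping.keys (mps_nth (f - 1) m) \<or> v \<in> Poly_Mapping.keys (mps_nth (1 :: ('a, 'b) B) m)"
      using v keys_mps_add[of "f - 1" 1 m] by auto
    moreover have "Poly_Mapping.keys (mps_nth (f - 1) m) \<subseteq> {(int j * a, int j * b) |j :: nat. 1 \<le> j}"
      using f by (simp add: vertex_series_def)
    moreover have "Poly_Mapping.keys (mps_nth (1 :: ('a, 'b) B) m) \<subseteq> {(int 0 * a, int 0 * b)}"
      by (simp add: zero_prod_def)
    ultimately show "v \<in> range (\<lambda>j. (int j * a, int j * b))" by blast
  qed
  with f show "f \<in> ray_series a b" by (simp add: ray_series_def vertex_series_def)
qed

lemma vertex_series_imp_ray_series: "f \<in> vertex_series a b \<Longrightarrow> f \<in> ray_series a b"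
  using vertex_series_subset_ray_series by (rule subsetD)

lemma ray_series_one: "1 \<in> ray_series a b"
proof -
  have "(0, 0) \<in> range (\<lambda>j. (int j * a, int j * b))" by (rule range_eqI[of _ _ 0]) simp
  then show ?thesis by (simp add: ray_series_def zero_prod_def)
qed

lemma ray_series_mult:
  assumes "f \<in> ray_series a b" "g \<in> ray_series a b"
  shows "f * g \<in> ray_series a b"
proof -
  have "Poly_Mapping.keys (mps_nth (f * g) m) \<subseteq> range (\<lambda>j. (int j * a, int j * b))" for m
  proof
    fix v assume "v \<in> Poly_Mapping.keys (mps_nth (f * g) m)"
    then obtain p q v1 v2 where *: "p + q = m" "v = v1 + v2" "v1 \<in> Poly_Mapping.keys (mps_nth f p)"
      "v2 \<in> Poly_Mapping.keys (mps_nth g q)" by (metis keys_mps_mult)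
    then obtain i j where "v1 = (int i * a, int i * b)" "v2 = (int j * a, int j * b)"
      using assms unfolding ray_series_def by blast
    then have "v = (int (i + j) * a, int (i + j) * b)"
      using * by (simp add: algebra_simps)
    then show "v \<in> range (\<lambda>j. (int j * a, int j * b))" by blast
  qed
  then show ?thesis using assms one_plus_max_ideal_mult by (auto simp: ray_series_def)
qed

lemma ray_series_prod: "(\<And>i. i \<in> A \<Longrightarrow> f i \<in> ray_series a b) \<Longrightarrow> prod f A \<in> ray_series a b"
  by (induction A rule: infinite_finite_induct) (auto intro: ray_series_one ray_series_mult)

lemma ray_series_one_plus: "1 + mps_monom {#v#} 1 * xy a b \<in> ray_series a b"
proof -
  have eq: "mps_monom {#v#} 1 * xy a b = mps_monom {#v#} (Poly_Mapping.single (a, b) 1)"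
    by (simp add: xy_def mps_monom_mult)
  have "(0, 0) \<in> range (\<lambda>j. (int j * a, int j * b))" by (rule range_eqI[of _ _ 0]) simp
  moreover have "(a, b) \<in> range (\<lambda>j. (int j * a, int j * b))" by (rule range_eqI[of _ _ 1]) simp
  ultimately show ?thesis unfolding eq
    by (auto simp: ray_series_def max_ideal_power_def mps_monom.rep_eq zero_prod_def split: if_splits)
qed

lemma R_hom_congruent_on_ray:
  fixes \<phi> :: "('k::finite, 'l::finite) B \<Rightarrow> ('k, 'l) B"
  assumes \<phi>: "R_hom \<phi>" and fix_ray: "\<phi> (xy a b) - xy a b \<in> max_ideal_power n" and f: "f \<in> ray_series a b"
  shows "\<phi> f - f \<in> max_ideal_power n"
proof -
  have "\<phi> f - id f \<in> max_ideal_power n"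
  proof (rule R_linear_mem[OF R_linear_hom_diff[OF \<phi> R_hom_id], of n])
    fix m u v assume "(u, v) \<in> Poly_Mapping.keys (mps_nth f m)"
    then obtain j where "(u, v) = (int j * a, int j * b)"
      using f unfolding ray_series_def by blast
    then have "xy u v = (xy a b :: ('k, 'l) B) ^ j" by (simp add: xy_power)
    then have "\<phi> (xy u v) - id (xy u v) = (\<Prod>i<j. \<phi> (xy a b)) - (\<Prod>i<j. xy a b)"
      by (simp add: R_hom_power[OF \<phi>])
    also have "\<dots> \<in> max_ideal_power n"
      by (rule max_ideal_power_prod_cong) (rule fix_ray)
    finally show "\<phi> (xy u v) - id (xy u v) \<in> max_ideal_power n" .
  qed (auto intro: max_ideal_power_add max_ideal_power_mult_left)
  then show ?thesis by simp
qed

lemma R_hom_fixes_ray_series: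
  fixes \<phi> :: "('k::finite, 'l::finite) B \<Rightarrow> ('k, 'l) B"
  assumes "R_hom \<phi>" "\<phi> (xy a b) = xy a b" "f \<in> ray_series a b"
  shows "\<phi> f = f"
  by (rule separated) (rule R_hom_congruent_on_ray, use assms in auto)

lemma R_hom_one_plus_max_ideal:
  fixes \<phi> :: "('k::finite, 'l::finite) B \<Rightarrow> ('k, 'l) B"
  assumes \<phi>: "R_hom \<phi>" and f: "f - 1 \<in> max_ideal_power 1"
  shows "\<phi> f - 1 \<in> max_ideal_power 1"
  using R_linear_continuous[OF R_hom_linear[OF \<phi>] f]
  by (simp add: R_linear_diff[OF R_hom_linear[OF \<phi>]] R_hom_one[OF \<phi>])

lemma R_hom_minv:
  fixes \<phi> :: "('k, 'l) B \<Rightarrow> ('k, 'l) B"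
  assumes \<phi>: "R_hom \<phi>" and f: "f - 1 \<in> max_ideal_power 1"
  shows "\<phi> (minv f) = minv (\<phi> f)"
proof -
  have "\<phi> f * \<phi> (minv f) = 1"
    by (metis R_hom_mult R_hom_one \<phi> f one_plus_max_ideal_inverse(1))
  then show ?thesis by (simp add: minv_eq)
qed

text \<open>For \<open>p = x g\<^sup>b\<close>, \<open>q = y f\<^sup>a\<close> the powers of \<open>f\<close> and \<open>g = f\<^sup>-\<^sup>1\<close> cancel in \<open>p\<^sup>a q\<^sup>b\<close>. Therefore \<open>x\<^sup>a y\<^sup>b\<close> is
  fixed, and with it every series in \<open>x\<^sup>a y\<^sup>b\<close>; this applies to \<open>f\<close> itself if it is one.\<close>

lemma twist_exists:
  fixes f :: "('k::finite, 'l::finite) B"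
  assumes fg: "f * g = 1"
  obtains \<phi> where "R_hom \<phi>" "\<phi> (xy 1 0) = xy 1 0 * g ^ b" "\<phi> (xy 0 1) = xy 0 1 * f ^ a"
    "\<phi> (xy (int a) (int b)) = xy (int a) (int b)"
proof -
  have fg_power: "f ^ i * g ^ i = 1" for i by (simp add: fg flip: power_mult_distrib)
  have unit: "xy u v * xy (- u) (- v) = 1" for u v by (simp add: xy_mult)
  have "(xy 1 0 * g ^ b) * (xy (- 1) 0 * f ^ b) = (xy 1 0 * xy (- 1) 0) * (f ^ b * g ^ b)"
    by (simp only: mult_ac)
  then have 1: "(xy 1 0 * g ^ b) * (xy (- 1) 0 * f ^ b) = 1"
    using unit[of 1 0] fg_power by simp
  have "(xy 0 1 * f ^ a) * (xy 0 (- 1) * g ^ a) = (xy 0 1 * xy 0 (- 1)) * (f ^ a * g ^ a)"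
    by (simp only: mult_ac)
  then have 2: "(xy 0 1 * f ^ a) * (xy 0 (- 1) * g ^ a) = 1"
    using unit[of 0 1] fg_power by simp
  obtain \<phi> where \<phi>: "R_hom \<phi>" "\<phi> (xy 1 0) = xy 1 0 * g ^ b" "\<phi> (xy 0 1) = xy 0 1 * f ^ a"
    using R_hom_exists[OF 1 2] .
  have "\<phi> (xy (int a) (int b)) = (xy 1 0 ^ a * xy 0 1 ^ b) * (f ^ (a * b) * g ^ (a * b))"
    unfolding R_hom_xy_nat[OF \<phi>(1)] \<phi>(2,3)
    by (simp add: power_mult_distrib mult_ac flip: power_mult)
  also have "\<dots> = xy (int a) (int b)"
    unfolding fg_power by (simp add: xy_power xy_mult)
  finally show ?thesis using that \<phi> by blast
qed

text \<open>The endomorphisms for \<open>f\<close> and for \<open>f\<^sup>-\<^sup>1\<close> fix \<open>f\<close>, so they are inverse to each other on \<open>x\<close> and \<open>y\<close>, and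
  hence everywhere.\<close>

lemma
  fixes f :: "('k::finite, 'l::finite) B"
  assumes f: "f \<in> ray_series (int a) (int b)"
  shows T_R_algebra_aut: "R_algebra_aut (T (int a) (int b) f)"
    and T_x: "T (int a) (int b) f (xy 1 0) = xy 1 0 * minv f ^ b"
    and T_y: "T (int a) (int b) f (xy 0 1) = xy 0 1 * f ^ a"
proof -
  have f1: "f - 1 \<in> max_ideal_power 1" using f by (simp add: ray_series_def)
  note inv = one_plus_max_ideal_inverse(1)[OF f1]
  obtain \<phi> where \<phi>: "R_hom \<phi>" "\<phi> (xy 1 0) = xy 1 0 * minv f ^ b" "\<phi> (xy 0 1) = xy 0 1 * f ^ a"
    "\<phi> (xy (int a) (int b)) = xy (int a) (int b)"
    using twist_exists[OF inv] .
  obtain \<psi> where \<psi>: "R_hom \<psi>" "\<psi> (xy 1 0) = xy 1 0 * f ^ b" "\<psi> (xy 0 1) = xy 0 1 * minv f ^ a"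
    "\<psi> (xy (int a) (int b)) = xy (int a) (int b)"
    using twist_exists[of "minv f" f] inv by (metis mult.commute)
  have fixed: "\<phi> f = f" "\<psi> f = f"
    using R_hom_fixes_ray_series f \<phi> \<psi> by blast+
  then have fixed': "\<phi> (minv f) = minv f" "\<psi> (minv f) = minv f"
    using R_hom_minv f1 \<phi> \<psi> by metis+
  have cancel: "minv f ^ i * f ^ i = 1" for i
    using inv by (simp add: mult.commute flip: power_mult_distrib)
  have "\<phi> \<circ> \<psi> = id"
    by (rule R_hom_eqI)
      (simp_all add: R_hom_comp R_hom_id \<phi>(1-3) \<psi>(1-3) R_hom_mult[OF \<phi>(1)] R_hom_power[OF \<phi>(1)]
        fixed fixed' mult.assoc cancel mult.commute[of "f ^ _" "minv f ^ _"])
  moreover have "\<psi> \<circ> \<phi> = id"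
    by (rule R_hom_eqI)
      (simp_all add: R_hom_comp R_hom_id \<phi>(1-3) \<psi>(1-3) R_hom_mult[OF \<psi>(1)] R_hom_power[OF \<psi>(1)]
        fixed fixed' mult.assoc cancel mult.commute[of "f ^ _" "minv f ^ _"])
  ultimately have aut: "R_algebra_aut \<phi>"
    using R_algebra_autI[OF \<phi>(1)] o_bij by blast
  have powi: "unit_powi f (int a) = f ^ a" "unit_powi f (- int b) = minv f ^ b"
    by (simp_all add: unit_powi_of_nat unit_powi_minus_of_nat[OF inv])
  have "T (int a) (int b) f = \<phi>"
    unfolding T_def powi
  proof (rule the_equality)
    fix \<phi>' assume "R_algebra_aut \<phi>' \<and> \<phi>' (xy 1 0) = xy 1 0 * minv f ^ b \<and> \<phi>' (xy 0 1) = xy 0 1 * f ^ a"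
    then show "\<phi>' = \<phi>"
      using \<phi> R_hom_of_aut R_hom_eqI by metis
  qed (use \<phi> aut in simp)
  then show "R_algebra_aut (T (int a) (int b) f)"
    "T (int a) (int b) f (xy 1 0) = xy 1 0 * minv f ^ b"
    "T (int a) (int b) f (xy 0 1) = xy 0 1 * f ^ a"
    using aut \<phi> by simp_all
qed

lemma R_hom_T: "f \<in> ray_series (int a) (int b) \<Longrightarrow> R_hom (T (int a) (int b) f)"
  for f :: "('k::finite, 'l::finite) B"
  by (intro R_hom_of_aut T_R_algebra_aut)

lemma T_fixes:
  fixes f :: "('k::finite, 'l::finite) B"
  assumes f: "f \<in> ray_series (int a) (int b)"
  shows "T (int a) (int b) f f = f"
proof (rule R_hom_fixes_ray_series[OF R_hom_T[OF f] _ f])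
  have inv: "f * minv f = 1"
    using f one_plus_max_ideal_inverse by (auto simp: ray_series_def)
  have "T (int a) (int b) f (xy (int a) (int b)) =
      (xy 1 0 ^ a * xy 0 1 ^ b) * (f * minv f) ^ (a * b)"
    unfolding R_hom_xy_nat[OF R_hom_T[OF f]] T_x[OF f] T_y[OF f]
    by (simp add: power_mult_distrib mult_ac flip: power_mult)
  then show "T (int a) (int b) f (xy (int a) (int b)) = xy (int a) (int b)"
    unfolding inv by (simp add: xy_power xy_mult)
qed


section \<open>Leading coefficients\<close>

text \<open>An endomorphism \<open>\<phi>\<close> is a family of curves with coordinates \<open>\<phi> x\<close> and \<open>\<phi> y\<close>, where \<open>x\<close> is the parameter
  on the curves and \<open>xy\<close> the parameter of the family. Here \<open>c\<close> and \<open>d\<close>, in the applications of degree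
  0, are the leading coefficients of \<open>\<phi> x / x\<close> and \<open>\<phi> y / y\<close> as functions on the curves, at \<open>x = 0\<close> if
  \<open>e = 1\<close> and at \<open>x = \<infinity>\<close> if \<open>e = -1\<close>.\<close>

definition leading :: "int \<Rightarrow> nat \<Rightarrow> ('k, 'l) B \<Rightarrow> ('k, 'l) B \<Rightarrow> (('k, 'l) B \<Rightarrow> ('k, 'l) B) \<Rightarrow> bool" where
  "leading e n c d \<phi> \<longleftrightarrow> (\<exists>p q. \<phi> (xy 1 0) = xy 1 0 * p \<and> \<phi> (xy 0 1) = xy 0 1 * q \<and>
     p - c \<in> filt e 1 n \<and> q - d \<in> filt e 1 n)"

lemma filt_of_cong: "p - c \<in> filt e 1 n \<Longrightarrow> c \<in> filt e 0 n \<Longrightarrow> p \<in> filt e 0 n"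
  using filt_add[of "p - c" e 0 n c] filt_mono[of 0 1 n n e] by auto

text \<open>If \<open>x\<^sup>i y\<^sup>j\<close> has positive degree, it vanishes on the curves at the point in question, so that a
  series without constant term in \<open>x\<^sup>i y\<^sup>j\<close> vanishes there as well.\<close>

lemma leading_vertex_series:
  fixes \<phi> :: "('k::finite, 'l::finite) B \<Rightarrow> ('k, 'l) B"
  assumes \<phi>: "R_hom \<phi>" "leading e n c d \<phi>" and cd: "c \<in> filt e 0 n" "d \<in> filt e 0 n"
    and f: "f \<in> vertex_series (int i) (int j)" and pos: "1 \<le> e * (int i - int j)"
  shows "\<phi> f - 1 \<in> filt e 1 n"
proof -
  obtain p q where pq: "\<phi> (xy 1 0) = xy 1 0 * p" "\<phi> (xy 0 1) = xy 0 1 * q"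
      "p - c \<in> filt e 1 n" "q - d \<in> filt e 1 n"
    using \<phi>(2) unfolding leading_def by blast
  have "\<phi> (f - 1) \<in> filt e 1 n"
  proof (rule R_linear_mem[OF R_hom_linear[OF \<phi>(1)] max_ideal_power_subset_filt])
    fix m u v assume "(u, v) \<in> Poly_Mapping.keys (mps_nth (f - 1) m)"
    then have "(u, v) \<in> {(int k * int i, int k * int j) |k :: nat. 1 \<le> k}"
      using f unfolding vertex_series_def by blast
    then obtain k :: nat where k: "u = int (k * i)" "v = int (k * j)" "1 \<le> k" by auto
    have "\<phi> (xy u v) = (xy 1 0 ^ (k * i) * xy 0 1 ^ (k * j)) * (p ^ (k * i) * q ^ (k * j))"
      unfolding k R_hom_xy_nat[OF \<phi>(1)] pq by (simp only: power_mult_distrib mult_ac)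
    also have "xy 1 0 ^ (k * i) * xy 0 1 ^ (k * j) = (xy u v :: ('k, 'l) B)"
      by (simp add: xy_power xy_mult k)
    finally have "\<phi> (xy u v) = xy u v * (p ^ (k * i) * q ^ (k * j))" .
    moreover have "1 * 1 \<le> int k * (e * (int i - int j))"
      using pos k(3) by (intro mult_mono) auto
    then have "1 \<le> e * (u - v)" by (simp add: k algebra_simps)
    then have "xy u v * (p ^ (k * i) * q ^ (k * j)) \<in> filt e 1 n"
      by (intro filt_mult_right filt_xy filt_mult_left[of _ e n _ 0] filt_power)
        (use pq cd filt_of_cong in auto)
    ultimately show "\<phi> (xy u v) \<in> filt e 1 n" by simp
  qed (auto intro: filt_add filt_mult_left filt_of_R)
  then show ?thesis
    by (simp add: R_linear_diff[OF R_hom_linear[OF \<phi>(1)]] R_hom_one[OF \<phi>(1)])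
qed

lemma filt_power_cong: "u - 1 \<in> filt e 1 n \<Longrightarrow> u ^ k - 1 \<in> filt e 1 n"
  using filt_prod_cong[of "{..<k}" "\<lambda>_. u" "\<lambda>_. 1" e n] by simp

lemma leading_scale:
  assumes "p - c \<in> filt e 1 n" "c \<in> filt e 0 n" "u - 1 \<in> filt e 1 n"
  shows "p * u ^ k - c \<in> filt e 1 n"
proof -
  have "p \<in> filt e 0 n" using assms filt_of_cong by blast
  then have "p * (u ^ k - 1) + (p - c) \<in> filt e 1 n"
    using assms by (intro filt_add filt_mult_left filt_power_cong) auto
  then show ?thesis by (simp add: algebra_simps)
qed

lemma minv_one [simp]: "minv 1 = 1"
  by (rule minv_eq) simp

text \<open>\<open>T\<close> multiplies \<open>x\<close> and \<open>y\<close> by powers of \<open>f\<close>, and \<open>\<phi> f\<close> has leading coefficient 1. The converse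
  direction works in the same way because \<open>\<phi> \<circ> T\<close> and \<open>\<phi>\<close> agree on \<open>f\<close>.\<close>

lemma leading_comp_T:
  fixes \<phi> :: "('k::finite, 'l::finite) B \<Rightarrow> ('k, 'l) B"
  assumes \<phi>: "R_hom \<phi>" and cd: "c \<in> filt e 0 n" "d \<in> filt e 0 n"
    and f: "f \<in> vertex_series (int i) (int j)" and pos: "1 \<le> e * (int i - int j)"
  shows "leading e n c d (\<phi> \<circ> T (int i) (int j) f) \<longleftrightarrow> leading e n c d \<phi>"
proof -
  have f': "f \<in> ray_series (int i) (int j)" and f1: "f - 1 \<in> max_ideal_power 1"
    by (rule vertex_series_imp_ray_series[OF f]) (use f in \<open>simp add: vertex_series_def\<close>)
  have \<phi>f: "\<phi> f - 1 \<in> max_ideal_power 1" by (rule R_hom_one_plus_max_ideal[OF \<phi> f1])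
  note inv = one_plus_max_ideal_inverse(1)[OF \<phi>f]
  have T: "(\<phi> \<circ> T (int i) (int j) f) (xy 1 0) = \<phi> (xy 1 0) * minv (\<phi> f) ^ j"
    "(\<phi> \<circ> T (int i) (int j) f) (xy 0 1) = \<phi> (xy 0 1) * \<phi> f ^ i"
    by (simp_all add: T_x[OF f'] T_y[OF f'] R_hom_mult[OF \<phi>] R_hom_power[OF \<phi>] R_hom_minv[OF \<phi> f1])
  have minv_cong: "minv (\<phi> f) - 1 \<in> filt e 1 n" if "\<phi> f - 1 \<in> filt e 1 n"
    using filt_minv_cong[OF \<phi>f, of 1 e n] that by simp
  have cancel: "minv (\<phi> f) ^ k * \<phi> f ^ k = 1" for k
    using inv by (simp add: mult.commute flip: power_mult_distrib)
  show ?thesis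
  proof
    assume lead: "leading e n c d \<phi>"
    then obtain p q where pq: "\<phi> (xy 1 0) = xy 1 0 * p" "\<phi> (xy 0 1) = xy 0 1 * q"
        "p - c \<in> filt e 1 n" "q - d \<in> filt e 1 n"
      unfolding leading_def by blast
    have 1: "\<phi> f - 1 \<in> filt e 1 n" by (rule leading_vertex_series[OF \<phi> lead cd f pos])
    show "leading e n c d (\<phi> \<circ> T (int i) (int j) f)"
      unfolding leading_def T
      by (rule exI[of _ "p * minv (\<phi> f) ^ j"], rule exI[of _ "q * \<phi> f ^ i"])
        (use pq cd 1 minv_cong[OF 1] in \<open>auto simp: mult.assoc intro: leading_scale\<close>)
  next
    assume lead: "leading e n c d (\<phi> \<circ> T (int i) (int j) f)"
    then obtain p q where pq: "\<phi> (xy 1 0) * minv (\<phi> f) ^ j = xy 1 0 * p" "\<phi> (xy 0 1) * \<phi> f ^ i = xy 0 1 * q"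
        "p - c \<in> filt e 1 n" "q - d \<in> filt e 1 n"
      unfolding leading_def T by blast
    have "(\<phi> \<circ> T (int i) (int j) f) f - 1 \<in> filt e 1 n"
      by (rule leading_vertex_series[OF R_hom_comp[OF \<phi> R_hom_T[OF f']] lead cd f pos])
    then have 1: "\<phi> f - 1 \<in> filt e 1 n" by (simp add: T_fixes[OF f'])
    have "xy 1 0 * (p * \<phi> f ^ j) = \<phi> (xy 1 0) * (minv (\<phi> f) ^ j * \<phi> f ^ j)"
      unfolding mult.assoc[symmetric] pq(1) ..
    moreover have "xy 0 1 * (q * minv (\<phi> f) ^ i) = \<phi> (xy 0 1) * (minv (\<phi> f) ^ i * \<phi> f ^ i)"
      unfolding mult.assoc[symmetric] pq(2)[symmetric] by (simp only: mult_ac)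
    ultimately have "\<phi> (xy 1 0) = xy 1 0 * (p * \<phi> f ^ j)" "\<phi> (xy 0 1) = xy 0 1 * (q * minv (\<phi> f) ^ i)"
      unfolding cancel by simp_all
    then show "leading e n c d \<phi>"
      unfolding leading_def using pq cd 1 minv_cong[OF 1] by (auto intro: leading_scale)
  qed
qed

lemma leading_cong:
  assumes lead: "leading e n c d \<phi>"
    and cong: "\<phi> (xy 1 0) - \<psi> (xy 1 0) \<in> max_ideal_power n" "\<phi> (xy 0 1) - \<psi> (xy 0 1) \<in> max_ideal_power n"
  shows "leading e n c d \<psi>"
proof -
  obtain p q where pq: "\<phi> (xy 1 0) = xy 1 0 * p" "\<phi> (xy 0 1) = xy 0 1 * q"
      "p - c \<in> filt e 1 n" "q - d \<in> filt e 1 n"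
    using lead unfolding leading_def by blast
  have unit: "xy 1 0 * (xy (- 1) 0 * g) = g" "xy 0 1 * (xy 0 (- 1) * g) = g" for g :: "('a, 'b) B"
    by (simp_all add: xy_mult flip: mult.assoc)
  have small: "xy u v * (\<phi> g - \<psi> g) \<in> filt e 1 n" if "\<phi> g - \<psi> g \<in> max_ideal_power n" for u v g
    using max_ideal_power_mult_left[OF that] max_ideal_power_subset_filt by blast
  have "xy (- 1) 0 * \<phi> (xy 1 0) = p" "xy 0 (- 1) * \<phi> (xy 0 1) = q"
    unfolding pq by (simp_all add: xy_mult flip: mult.assoc)
  then have "xy (- 1) 0 * \<psi> (xy 1 0) - c = (p - c) - xy (- 1) 0 * (\<phi> (xy 1 0) - \<psi> (xy 1 0))"
    "xy 0 (- 1) * \<psi> (xy 0 1) - d = (q - d) - xy 0 (- 1) * (\<phi> (xy 0 1) - \<psi> (xy 0 1))"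
    by (simp_all add: algebra_simps)
  then have "xy (- 1) 0 * \<psi> (xy 1 0) - c \<in> filt e 1 n" "xy 0 (- 1) * \<psi> (xy 0 1) - d \<in> filt e 1 n"
    by (simp_all only: filt_diff pq(3,4) small cong)
  then show ?thesis unfolding leading_def
    by (intro exI conjI) (simp_all add: unit)
qed

lemma T_product_Nil [simp]: "T_product f [] = id"
  and T_product_Cons: "T_product f (v # ps) = T (int (fst v)) (int (snd v)) (f v) \<circ> T_product f ps"
  by (simp_all add: T_product_def)

lemma T_product_append: "T_product f (ps @ qs) = T_product f ps \<circ> T_product f qs"
  by (induction ps) (simp_all add: T_product_Cons comp_assoc)

lemma R_hom_T_product:
  fixes f :: "nat \<times> nat \<Rightarrow> ('k::finite, 'l::finite) B"
  assumes "\<And>v. v \<in> set ps \<Longrightarrow> f v \<in> vertex_series (int (fst v)) (int (snd v))"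
  shows "R_hom (T_product f ps)"
  using assms
proof (induction ps)
  case (Cons v ps)
  have "f v \<in> ray_series (int (fst v)) (int (snd v))"
    by (intro vertex_series_imp_ray_series Cons.prems) simp
  with Cons show ?case
    unfolding T_product_Cons by (intro R_hom_comp R_hom_T) auto
qed (simp add: R_hom_id)

lemma leading_comp_T_product:
  fixes f :: "nat \<times> nat \<Rightarrow> ('k::finite, 'l::finite) B"
  assumes "R_hom \<phi>" and "c \<in> filt e 0 n" "d \<in> filt e 0 n"
    and "\<And>v. v \<in> set ps \<Longrightarrow> f v \<in> vertex_series (int (fst v)) (int (snd v))"
    and "\<And>v. v \<in> set ps \<Longrightarrow> 1 \<le> e * (int (fst v) - int (snd v))"
  shows "leading e n c d (\<phi> \<circ> T_product f ps) \<longleftrightarrow> leading e n c d \<phi>"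
  using assms
proof (induction ps arbitrary: \<phi>)
  case (Cons v ps)
  define \<psi> where "\<psi> = \<phi> \<circ> T (int (fst v)) (int (snd v)) (f v)"
  have "f v \<in> ray_series (int (fst v)) (int (snd v))"
    by (intro vertex_series_imp_ray_series Cons.prems) simp
  then have "R_hom \<psi>" using Cons.prems(1) unfolding \<psi>_def by (intro R_hom_comp R_hom_T)
  then have "leading e n c d (\<psi> \<circ> T_product f ps) \<longleftrightarrow> leading e n c d \<psi>"
    using Cons.prems by (intro Cons.IH) auto
  also have "\<dots> \<longleftrightarrow> leading e n c d \<phi>"
    unfolding \<psi>_def using Cons.prems by (intro leading_comp_T) auto
  finally show ?case by (simp only: \<psi>_def T_product_Cons comp_assoc)
qed simp

lemma filt_units: "c * d = 1 \<Longrightarrow> p - c \<in> filt e 1 n \<Longrightarrow> q - d \<in> filt e 1 n \<Longrightarrow>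
  c \<in> filt e 0 n \<Longrightarrow> d \<in> filt e 0 n \<Longrightarrow> p * q - 1 \<in> filt e 1 n"
  using filt_add[of "(p - c) * q" e 1 n "c * (q - d)"] filt_mult_right[of "p - c" e 1 n q]
    filt_mult_left[of c e n "q - d" 1] filt_of_cong[of q d e n]
  by (simp add: algebra_simps)

text \<open>With \<open>\<psi> = \<phi> \<circ> \<theta>\<^sub>-\<close>, where \<open>\<theta>\<^sub>-\<close> is the product over \<open>ps\<close>, write \<open>\<psi> x = x p\<close> and \<open>\<psi> y = y q\<close>. At infinity
  \<open>p\<close> and \<open>q\<close> have leading coefficient 1. Removing the product over \<open>qs\<close> shows that at 0, \<open>p / \<psi> f\<close> and
  \<open>q \<psi> f\<close> have the leading coefficients \<open>c\<close> and \<open>d\<close>, where \<open>f\<close> stands for \<open>f (1, 1)\<close>. Their product \<open>p q\<close>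
  has leading coefficient 1 at both ends and therefore equals 1. So, modulo \<open>\<mm>\<^sup>n\<close>, \<open>\<psi>\<close> fixes \<open>xy\<close> and \<open>f\<close>,
  and \<open>q f\<close> has the leading coefficient \<open>d\<close> at 0 and \<open>f\<close> at infinity.\<close>

lemma vertex_series_from_leading:
  fixes f :: "nat \<times> nat \<Rightarrow> ('k::finite, 'l::finite) B"
  assumes vs: "\<And>v. v \<in> set ps \<union> {(1, 1)} \<union> set qs \<Longrightarrow> f v \<in> vertex_series (int (fst v)) (int (snd v))"
    and ps: "\<And>v. v \<in> set ps \<Longrightarrow> fst v < snd v"
    and qs: "\<And>v. v \<in> set qs \<Longrightarrow> snd v < fst v"
    and \<phi>: "R_hom \<phi>" "leading (- 1) n 1 1 \<phi>"
    and lead: "leading 1 n c d (\<phi> \<circ> T_product f (ps @ (1, 1) # qs))"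
    and cd: "c * d = 1" "\<And>e. c \<in> filt e 0 n" "\<And>e. d \<in> filt e 0 n"
  shows "f (1, 1) - d \<in> max_ideal_power n"
proof -
  define g where "g = f (1, 1)"
  have g: "g \<in> vertex_series (int 1) (int 1)" using vs[of "(1, 1)"] by (simp add: g_def)
  then have g': "g \<in> ray_series (int 1) (int 1)" and g1: "g - 1 \<in> max_ideal_power 1"
    by (rule vertex_series_imp_ray_series) (use g in \<open>simp add: vertex_series_def\<close>)
  define \<psi> where "\<psi> = \<phi> \<circ> T_product f ps"
  have \<psi>: "R_hom \<psi>"
    unfolding \<psi>_def using vs by (intro R_hom_comp R_hom_T_product \<phi>) auto
  define \<omega> where "\<omega> = \<psi> \<circ> T (int 1) (int 1) g"
  have "R_hom \<omega>" unfolding \<omega>_def by (intro R_hom_comp R_hom_T \<psi> g')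
  moreover have "leading 1 n c d (\<omega> \<circ> T_product f qs)"
    using lead by (simp add: \<omega>_def \<psi>_def T_product_append T_product_Cons g_def comp_assoc)
  ultimately have lead1: "leading 1 n c d \<omega>"
    using leading_comp_T_product[of \<omega> c 1 n d qs f] vs qs cd by force
  have "leading (- 1) n 1 1 \<psi>"
    unfolding \<psi>_def using leading_comp_T_product[of \<phi> 1 "- 1" n 1 ps f] vs ps \<phi> by force
  then obtain p q where pq: "\<psi> (xy 1 0) = xy 1 0 * p" "\<psi> (xy 0 1) = xy 0 1 * q"
      "p - 1 \<in> filt (- 1) 1 n" "q - 1 \<in> filt (- 1) 1 n"
    unfolding leading_def by blast
  define G where "G = \<psi> g"
  have G1: "G - 1 \<in> max_ideal_power 1" unfolding G_def by (rule R_hom_one_plus_max_ideal[OF \<psi> g1])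
  note inv = one_plus_max_ideal_inverse(1)[OF G1]
  have \<omega>: "\<omega> (xy 1 0) = xy 1 0 * (p * minv G)" "\<omega> (xy 0 1) = xy 0 1 * (q * G)"
    unfolding \<omega>_def G_def
    using T_x[OF g'] T_y[OF g'] pq R_hom_mult[OF \<psi>] R_hom_minv[OF \<psi> g1] 
    by (simp_all add: mult.assoc)
  obtain p' q' where pq': "xy 1 0 * (p * minv G) = xy 1 0 * p'" "xy 0 1 * (q * G) = xy 0 1 * q'"
      "p' - c \<in> filt 1 1 n" "q' - d \<in> filt 1 1 n"
    using lead1 unfolding leading_def \<omega> by blast
  have cancel: "h = h'" if "xy u v * h = xy u v * h'" for h h' :: "('k, 'l) B" and u v
  proof -
    have "xy (- u) (- v) * (xy u v * h) = xy (- u) (- v) * (xy u v * h')" using that by simp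
    then show ?thesis by (simp add: xy_mult flip: mult.assoc)
  qed
  have pq'': "p' = p * minv G" "q' = q * G" using pq'(1,2) cancel by metis+
  have "p' * q' = p * q * (G * minv G)" unfolding pq'' by (simp add: mult_ac)
  then have eq: "p' * q' = p * q" by (simp add: inv)
  have 1: "p * q - 1 \<in> filt 1 1 n"
    using filt_units[of c d p' 1 n q'] pq' cd eq by simp
  have 2: "p * q - 1 \<in> filt (- 1) 1 n"
    using filt_units[of 1 1 p "- 1" n q] pq by simp
  have "(p * q - 1) - 0 \<in> max_ideal_power n"
    by (rule filt_opposite) (use 1 2 filt_mono[of 0 1 n n] in auto)
  then have pq1: "p * q - 1 \<in> max_ideal_power n" by simp
  have "\<psi> (xy 1 1) = (xy 1 0 * p) * (xy 0 1 * q)"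
    using R_hom_xy_nat[OF \<psi>, of 1 1] pq(1,2) by simp
  also have "\<dots> = (xy 1 0 * xy 0 1) * (p * q)" by (simp only: mult_ac)
  finally have "\<psi> (xy 1 1) = xy 1 1 * (p * q)" by (simp add: xy_mult)
  then have "\<psi> (xy 1 1) - xy 1 1 = xy 1 1 * (p * q - 1)" by (simp add: algebra_simps)
  then have "\<psi> (xy 1 1) - xy 1 1 \<in> max_ideal_power n"
    using pq1 max_ideal_power_mult_left by metis
  then have Gg: "G - g \<in> max_ideal_power n"
    unfolding G_def using R_hom_congruent_on_ray[OF \<psi>] g' by simp
  have "g \<in> filt e 0 n" for e
    using g' unfolding ray_series_def filt_def by fastforce
  then have G0: "G \<in> filt e 0 n" for e
    using filt_add[OF subsetD[OF max_ideal_power_subset_filt Gg]] by fastforce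
  have "(q * G - d) - (q * G - G) \<in> max_ideal_power n"
  proof (rule filt_opposite)
    show "q * G - d \<in> filt 1 1 n" using pq'(4) by (simp add: pq'')
    have "(q - 1) * G \<in> filt (- 1) 1 n" by (intro filt_mult_right G0 pq)
    then show "q * G - G \<in> filt (- 1) 1 n" by (simp add: algebra_simps)
    have "G - d \<in> filt e 0 n" for e by (intro filt_diff G0 cd)
    then show "q * G - d - (q * G - G) \<in> filt 1 0 n" "q * G - d - (q * G - G) \<in> filt (- 1) 0 n"
      by simp_all
  qed
  from max_ideal_power_diff[OF this Gg] show ?thesis by (simp add: g_def)
qed


section \<open>The curves\<close>

text \<open>Polynomial division of \<open>\<Prod>(1 + a z)\<close> by \<open>z + b\<close>: the remainder is the value at \<open>- b\<close>, and \<open>G\<^sub>0\<close> is the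
  leading coefficient of the quotient \<open>G\<close>. The equation for \<open>b G\<^sub>0\<close> comes from \<open>z = 0\<close>; it does not
  determine \<open>G\<^sub>0\<close> if \<open>b = 0\<close>, so \<open>G\<^sub>0\<close> is constructed along with \<open>G\<close>.\<close>

lemma linear_factor_quotient:
  assumes "finite A" and z: "z \<in> filt e 1 n" and a: "\<And>i. i \<in> A \<Longrightarrow> a i \<in> filt e 0 n"
    and b: "b \<in> filt e 0 n"
  obtains G G0 where "(\<Prod>i\<in>A. 1 + a i * z) = (\<Prod>i\<in>A. 1 - a i * b) + (z + b) * G"
    "b * G0 = 1 - (\<Prod>i\<in>A. 1 - a i * b)" "G - G0 \<in> filt e 1 n" "G \<in> filt e 0 n"
proof -
  have z0: "z \<in> filt e 0 n" using z filt_mono[of 0 1 n n e] by auto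
  have "\<exists>G G0. (\<Prod>i\<in>A. 1 + a i * z) = (\<Prod>i\<in>A. 1 - a i * b) + (z + b) * G \<and>
    b * G0 = 1 - (\<Prod>i\<in>A. 1 - a i * b) \<and> G - G0 \<in> filt e 1 n \<and> G \<in> filt e 0 n"
    using assms(1) a
  proof (induction A rule: finite_induct)
    case empty
    then show ?case by (intro exI[of _ 0]) simp
  next
    case (insert i A)
    define P where "P = (\<Prod>i\<in>A. 1 - a i * b)"
    obtain G G0 where G: "(\<Prod>i\<in>A. 1 + a i * z) = P + (z + b) * G" "b * G0 = 1 - P"
        "G - G0 \<in> filt e 1 n" "G \<in> filt e 0 n"
      using insert unfolding P_def by auto
    have P: "P \<in> filt e 0 n"
      unfolding P_def using insert b by (intro filt_prod filt_diff filt_one filt_mult_left) auto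
    have ai: "a i \<in> filt e 0 n" using insert by simp
    have "(\<Prod>i\<in>insert i A. 1 + a i * z) =
        (\<Prod>i\<in>insert i A. 1 - a i * b) + (z + b) * (a i * P + (1 + a i * z) * G)"
      using insert.hyps by (simp add: G(1) flip: P_def) (simp add: algebra_simps)
    moreover have "b * (a i * P + G0) = 1 - (\<Prod>i\<in>insert i A. 1 - a i * b)"
      using insert.hyps by (simp add: distrib_left G(2) flip: P_def) (simp add: algebra_simps)
    moreover have "a i * z * G + (G - G0) \<in> filt e 1 n"
      by (intro filt_add filt_mult_right filt_mult_left[of "a i"] G z ai)
    then have "a i * P + (1 + a i * z) * G - (a i * P + G0) \<in> filt e 1 n"
      by (simp add: algebra_simps)
    moreover have "a i * P + (1 + a i * z) * G \<in> filt e 0 n"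
      by (intro filt_add filt_mult_left ai P G filt_one z0)
    ultimately show ?case by blast
  qed
  then show ?thesis using that by blast
qed

text \<open>Because of the equation for \<open>b\<close>, \<open>z = - b\<close> is a zero of \<open>1 + \<sigma> z\<^sup>-\<^sup>1 \<Prod>(1 + a z)\<close>, so that the factor
  \<open>1 + b z\<^sup>-\<^sup>1\<close> splits off. It carries the pole at \<open>z = 0\<close>, and the cofactor \<open>Q\<close> is regular there. The same
  lemma serves for the zeros near \<open>x = 0\<close>, with \<open>z = x\<close>, and near \<open>x = \<infinity>\<close>, with \<open>z = x\<^sup>-\<^sup>1\<close>.\<close>

lemma curve_factorization:
  fixes z z' :: "('k, 'l) B"
  assumes "finite A" and zz': "z * z' = 1" and z: "z \<in> filt e 1 n"
    and a: "\<And>i. i \<in> A \<Longrightarrow> a i \<in> filt e 0 n" and b: "b \<in> filt e 0 n" "b \<in> max_ideal_power 1"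
    and \<sigma>: "\<sigma> \<in> filt e 0 n" "\<sigma> \<in> max_ideal_power 1"
    and b_eq: "b = \<sigma> * (\<Prod>i\<in>A. 1 - a i * b)" and E: "E * (\<Prod>i\<in>A. 1 - a i * b) = 1"
  obtains Q where "1 + \<sigma> * z' * (\<Prod>i\<in>A. 1 + a i * z) = (1 + b * z') * Q"
    "Q - E \<in> filt e 1 n" "Q - 1 \<in> max_ideal_power 1"
proof -
  define P where "P = (\<Prod>i\<in>A. 1 - a i * b)"
  obtain G G0 where G: "(\<Prod>i\<in>A. 1 + a i * z) = P + (z + b) * G"
    "b * G0 = 1 - P" "G - G0 \<in> filt e 1 n" "G \<in> filt e 0 n"
    by (rule linear_factor_quotient[OF assms(1) z a b(1)]) (auto simp: P_def)
  have bP: "b = \<sigma> * P" "E * P = 1" using b_eq E by (simp_all add: P_def)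
  have "\<sigma> * z' * (P + (z + b) * G) = b * z' + (z * z') * \<sigma> * G + b * z' * (\<sigma> * G)"
    by (simp add: bP(1) algebra_simps)
  then have 1: "1 + \<sigma> * z' * (\<Prod>i\<in>A. 1 + a i * z) = (1 + b * z') * (1 + \<sigma> * G)"
    unfolding G(1) zz' by (simp add: algebra_simps)
  have "\<sigma> * G0 = (E * P) * (\<sigma> * G0)" by (simp add: bP)
  also have "\<dots> = E * (b * G0)" by (simp add: bP(1) mult_ac)
  also have "\<dots> = E - E * P" unfolding G by (simp add: algebra_simps)
  finally have "1 + \<sigma> * G - E = \<sigma> * (G - G0)" by (simp add: bP algebra_simps)
  moreover have "\<sigma> * (G - G0) \<in> filt e 1 n" by (intro filt_mult_left G \<sigma>)
  ultimately have 2: "1 + \<sigma> * G - E \<in> filt e 1 n" by simp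
  have 3: "1 + \<sigma> * G - 1 \<in> max_ideal_power 1" using max_ideal_power_mult_right[OF \<sigma>(2)] by simp
  show ?thesis by (rule that[OF 1 2 3])
qed

lemma one_plus_max_ideal_cancel:
  assumes "g - 1 \<in> max_ideal_power 1" "g * h = g * h'"
  shows "h = h'"
proof -
  have "minv g * (g * h) = minv g * (g * h')" using assms(2) by simp
  then have "(g * minv g) * h = (g * minv g) * h'" by (simp only: mult_ac)
  then show ?thesis by (simp add: one_plus_max_ideal_inverse[OF assms(1)])
qed

text \<open>The functional equations of the series \<open>D k l = 1 / (1 - \<alpha>\<^sub>k \<beta>\<^sub>l)\<close> attached to the zeros of the curves.\<close>

definition vertex_system :: "('k::finite \<Rightarrow> 'l::finite \<Rightarrow> ('k, 'l) B) \<Rightarrow> bool" where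
  "vertex_system D \<longleftrightarrow> (\<forall>k l. D k l = 1 + svar k * tvar l * xy 1 1 * (\<Prod>i\<in>- {k}. \<Prod>j\<in>- {l}. D i j))"

lemma svar_tvar_max: "svar k * tvar l * xy 1 1 \<in> max_ideal_power 1"
  by (intro max_ideal_power_mult_right max_ideal_power_svar)

lemma vertex_system_exists:
  obtains D :: "'k::finite \<Rightarrow> 'l::finite \<Rightarrow> ('k, 'l) B" where "vertex_system D"
proof -
  define F :: "('k \<times> 'l \<Rightarrow> ('k, 'l) B) \<Rightarrow> 'k \<times> 'l \<Rightarrow> ('k, 'l) B" where
    "F D v = 1 + svar (fst v) * tvar (snd v) * xy 1 1 * (\<Prod>i\<in>- {fst v}. \<Prod>j\<in>- {snd v}. D (i, j))" for D v
  obtain D where D: "\<And>v. D v = F D v"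
  proof (rule contraction_fixed_point[of F])
    fix D D' :: "'k \<times> 'l \<Rightarrow> ('k, 'l) B" and n v
    assume D: "\<And>v. D v - D' v \<in> max_ideal_power n"
    have "svar (fst v) * tvar (snd v) * xy 1 1 * ((\<Prod>i\<in>- {fst v}. \<Prod>j\<in>- {snd v}. D (i, j)) -
        (\<Prod>i\<in>- {fst v}. \<Prod>j\<in>- {snd v}. D' (i, j))) \<in> max_ideal_power (Suc n)"
      by (intro max_ideal_power_mult_Suc svar_tvar_max max_ideal_power_prod_cong D)
    then show "F D v - F D' v \<in> max_ideal_power (Suc n)"
      by (simp add: F_def algebra_simps)
  qed blast
  have "vertex_system (\<lambda>k l. D (k, l))"
    unfolding vertex_system_def
    by (intro allI) (rule D[of "(_, _)", unfolded F_def fst_conv snd_conv])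
  then show ?thesis by (rule that)
qed

lemma vertex_system_filt:
  assumes D: "vertex_system D"
  shows "D k l \<in> filt e 0 n"
proof (induction n arbitrary: k l)
  case 0
  then show ?case by (simp add: filt_def)
next
  case (Suc n)
  have "svar k * tvar l * xy 1 1 * (\<Prod>i\<in>- {k}. \<Prod>j\<in>- {l}. D i j) \<in> filt e (0 + 0) (Suc n)"
    by (intro filt_mult_gain svar_tvar_max filt_prod Suc filt_mult_left filt_xy) auto
  then have "1 + svar k * tvar l * xy 1 1 * (\<Prod>i\<in>- {k}. \<Prod>j\<in>- {l}. D i j) \<in> filt e 0 (Suc n)"
    by (intro filt_add) auto
  then show ?case using D unfolding vertex_system_def by metis
qed

lemma vertex_system_one_plus:
  assumes D: "vertex_system D"
  shows "D k l - 1 \<in> max_ideal_power 1"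
proof -
  have "D k l - 1 = svar k * tvar l * xy 1 1 * (\<Prod>i\<in>- {k}. \<Prod>j\<in>- {l}. D i j)"
    using D unfolding vertex_system_def by (metis add_diff_cancel_left')
  then show ?thesis using max_ideal_power_mult_right[OF svar_tvar_max] by simp
qed

lemma prod_UNIV_remove: "(\<Prod>i\<in>UNIV. f i) = f (k::'k::finite) * (\<Prod>i\<in>- {k}. f i)"
  by (subst prod.remove[of UNIV k]) (simp_all add: Compl_eq_Diff_UNIV)

lemma filt_x: "xy 1 0 \<in> filt 1 1 n" "xy (- 1) 0 \<in> filt (- 1) 1 n"
  by (auto intro: filt_xy)

text \<open>The family of curves. The map \<open>\<phi>\<close> is the parametrization in the chart at \<open>x = \<infinity>\<close>, with coordinates \<open>X\<close>
  and \<open>Y / \<Prod>(1 + s\<^sub>k X)\<close>, and \<open>\<phi> \<circ> \<theta>\<close> the one in the chart at \<open>x = 0\<close>, with coordinates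
  \<open>X / \<Prod>(1 + t\<^sub>l Y)\<close> and \<open>Y\<close>. By \<open>curve_factorization\<close> the denominators cancel the zeros of the
  numerators, which leaves the cofactors \<open>Q\<close> and \<open>Q\<^sub>l'\<close> with known leading coefficients.\<close>

lemma vertex_curve:
  fixes D :: "'k::finite \<Rightarrow> 'l::finite \<Rightarrow> ('k, 'l) B"
  assumes D: "vertex_system D"
  defines "P \<equiv> \<Prod>k\<in>UNIV. \<Prod>l\<in>UNIV. D k l"
  defines "\<theta> \<equiv> T 1 0 (\<Prod>k\<in>UNIV. 1 + svar k * xy 1 0) \<circ> T 0 1 (\<Prod>l\<in>UNIV. 1 + tvar l * xy 0 1)"
  obtains \<phi> where "R_hom \<phi>" "leading (- 1) n 1 1 \<phi>" "leading 1 n (minv P) P (\<phi> \<circ> \<theta>)"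
proof -
  define E where "E k l = minv (D k l)" for k l
  note D1 = vertex_system_one_plus[OF D] and D0 = vertex_system_filt[OF D]
  have DE: "D k l * E k l = 1" for k l
    using one_plus_max_ideal_inverse[OF D1] by (simp add: E_def)
  have E0: "E k l \<in> filt e 0 m" for k l e m
    unfolding E_def by (rule filt_minv[OF D1 D0])
  define x x' y :: "('k, 'l) B" where "x = xy 1 0" and "x' = xy (- 1) 0" and "y = xy 0 1"
  have xx': "x * x' = 1" "x' * x = 1" by (simp_all add: x_def x'_def xy_mult)
  have x1: "x \<in> filt 1 1 n" and x'1: "x' \<in> filt (- 1) 1 n"
    by (simp_all add: x_def x'_def filt_x)
  have P1: "P - 1 \<in> max_ideal_power 1" unfolding P_def by (intro one_plus_max_ideal_prod D1)
  have P0: "P \<in> filt e 0 m" for e m unfolding P_def by (intro filt_prod D0)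
  have PE: "minv P = (\<Prod>k\<in>UNIV. \<Prod>l\<in>UNIV. E k l)"
    by (rule minv_eq) (simp add: P_def DE flip: prod.distrib)
  then have PE': "minv P = (\<Prod>l\<in>UNIV. \<Prod>k\<in>UNIV. E k l)"
    using prod.swap[of E UNIV UNIV] by simp

  define \<alpha> where "\<alpha> k = svar k * (\<Prod>l\<in>UNIV. E k l)" for k
  define \<sigma> where "\<sigma> l = tvar l * xy 1 1 * P" for l
  define \<beta> where "\<beta> l = \<sigma> l * (\<Prod>k\<in>UNIV. E k l)" for l
  \<comment> \<open>With the products \<open>p1, p2, p3\<close> over the row of \<open>(k, l)\<close>, its column and the complement of both,
    \<open>\<alpha>\<^sub>k \<beta>\<^sub>l\<close> is \<open>s\<^sub>k t\<^sub>l x y p3 / D k l\<close>, and the functional equation of \<open>D k l\<close> applies.\<close>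
  have \<alpha>\<beta>: "1 - \<alpha> k * \<beta> l = E k l" for k l
  proof -
    define p1 where "p1 = (\<Prod>j\<in>- {l}. D k j)"
    define p2 where "p2 = (\<Prod>i\<in>- {k}. D i l)"
    define p3 where "p3 = (\<Prod>i\<in>- {k}. \<Prod>j\<in>- {l}. D i j)"
    define q1 where "q1 = (\<Prod>j\<in>- {l}. E k j)"
    define q2 where "q2 = (\<Prod>i\<in>- {k}. E i l)"
    have pq: "p1 * q1 = 1" "p2 * q2 = 1"
      by (simp_all add: p1_def q1_def p2_def q2_def DE flip: prod.distrib)
    have P_eq: "P = D k l * p1 * (p2 * p3)"
      unfolding P_def prod_UNIV_remove[of _ k] prod_UNIV_remove[of _ l] p1_def p2_def p3_def
      by (simp add: prod.distrib)
    have "D k l * (\<alpha> k * \<beta> l) =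
        D k l * (svar k * (E k l * q1) * (tvar l * xy 1 1 * (D k l * p1 * (p2 * p3)) * (E k l * q2)))"
      unfolding \<alpha>_def \<beta>_def \<sigma>_def P_eq prod_UNIV_remove[of _ k] prod_UNIV_remove[of _ l] q1_def q2_def ..
    also have "\<dots> = (svar k * tvar l * xy 1 1 * p3) * (D k l * E k l) * (D k l * E k l) * (p1 * q1) * (p2 * q2)"
      by (simp only: mult_ac)
    also have "\<dots> = D k l - 1"
      unfolding DE pq using D unfolding vertex_system_def p3_def by (metis add_diff_cancel_left' mult.right_neutral)
    finally have "D k l * (1 - \<alpha> k * \<beta> l) = D k l * E k l"
      by (simp add: DE algebra_simps)
    then show ?thesis by (rule one_plus_max_ideal_cancel[OF D1])
  qed
  have \<alpha>: "\<alpha> k \<in> filt e 0 m" "\<alpha> k \<in> max_ideal_power 1" for k e m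
    unfolding \<alpha>_def by (intro filt_mult_left filt_svar filt_prod E0)
      (intro max_ideal_power_mult_right max_ideal_power_svar)
  have \<sigma>: "\<sigma> l \<in> filt e 0 m" "\<sigma> l \<in> max_ideal_power 1" for l e m
    unfolding \<sigma>_def by (intro filt_mult_left filt_tvar P0 filt_xy, simp)
      (intro max_ideal_power_mult_right max_ideal_power_tvar)
  have \<beta>: "\<beta> l \<in> filt e 0 m" "\<beta> l \<in> max_ideal_power 1" for l e m
    unfolding \<beta>_def by (intro filt_mult_left \<sigma> filt_prod E0)
      (intro max_ideal_power_mult_right \<sigma>)

  have "\<exists>Q. 1 + svar k * x * (\<Prod>l\<in>UNIV. 1 + \<beta> l * x') = (1 + \<alpha> k * x) * Q \<and>
    Q - (\<Prod>l\<in>UNIV. D k l) \<in> filt (- 1) 1 n \<and> Q - 1 \<in> max_ideal_power 1" for k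
  proof -
    have 1: "(\<Prod>l\<in>UNIV. 1 - \<beta> l * \<alpha> k) = (\<Prod>l\<in>UNIV. E k l)"
      by (simp add: \<alpha>\<beta> mult.commute[of "\<beta> _"])
    have 2: "\<alpha> k = svar k * (\<Prod>l\<in>UNIV. 1 - \<beta> l * \<alpha> k)"
      unfolding 1 by (rule \<alpha>_def)
    have 3: "(\<Prod>l\<in>UNIV. D k l) * (\<Prod>l\<in>UNIV. 1 - \<beta> l * \<alpha> k) = 1"
      unfolding 1 by (simp add: DE flip: prod.distrib)
    obtain Q where "1 + svar k * x * (\<Prod>l\<in>UNIV. 1 + \<beta> l * x') = (1 + \<alpha> k * x) * Q"
      "Q - (\<Prod>l\<in>UNIV. D k l) \<in> filt (- 1) 1 n" "Q - 1 \<in> max_ideal_power 1"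
      by (rule curve_factorization[OF finite_class.finite_UNIV xx'(2) x'1 \<beta>(1) \<alpha> filt_svar max_ideal_power_svar 2 3])
    then show ?thesis by blast
  qed
  then obtain Q where Q: "\<And>k. 1 + svar k * x * (\<Prod>l\<in>UNIV. 1 + \<beta> l * x') = (1 + \<alpha> k * x) * Q k"
    "\<And>k. Q k - (\<Prod>l\<in>UNIV. D k l) \<in> filt (- 1) 1 n" "\<And>k. Q k - 1 \<in> max_ideal_power 1"
    by metis
  have "\<exists>Q. 1 + \<sigma> l * x' * (\<Prod>k\<in>UNIV. 1 + \<alpha> k * x) = (1 + \<beta> l * x') * Q \<and>
    Q - (\<Prod>k\<in>UNIV. D k l) \<in> filt 1 1 n \<and> Q - 1 \<in> max_ideal_power 1" for l
  proof -
    have 1: "(\<Prod>k\<in>UNIV. 1 - \<alpha> k * \<beta> l) = (\<Prod>k\<in>UNIV. E k l)"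
      by (simp add: \<alpha>\<beta>)
    have 2: "\<beta> l = \<sigma> l * (\<Prod>k\<in>UNIV. 1 - \<alpha> k * \<beta> l)"
      unfolding 1 by (rule \<beta>_def)
    have 3: "(\<Prod>k\<in>UNIV. D k l) * (\<Prod>k\<in>UNIV. 1 - \<alpha> k * \<beta> l) = 1"
      unfolding 1 by (simp add: DE flip: prod.distrib)
    obtain Q where "1 + \<sigma> l * x' * (\<Prod>k\<in>UNIV. 1 + \<alpha> k * x) = (1 + \<beta> l * x') * Q"
      "Q - (\<Prod>k\<in>UNIV. D k l) \<in> filt 1 1 n" "Q - 1 \<in> max_ideal_power 1"
      by (rule curve_factorization[OF finite_class.finite_UNIV xx'(1) x1 \<alpha>(1) \<beta> \<sigma> 2 3])
    then show ?thesis by blast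
  qed
  then obtain Q' where Q': "\<And>l. 1 + \<sigma> l * x' * (\<Prod>k\<in>UNIV. 1 + \<alpha> k * x) = (1 + \<beta> l * x') * Q' l"
    "\<And>l. Q' l - (\<Prod>k\<in>UNIV. D k l) \<in> filt 1 1 n" "\<And>l. Q' l - 1 \<in> max_ideal_power 1"
    by metis

  \<comment> \<open>\<open>X = x p\<close>, and in \<open>Y / \<Prod>(1 + s\<^sub>k X)\<close> with \<open>Y = y P \<Prod>(1 + \<alpha>\<^sub>k x)\<close> only \<open>y q\<close> remains.\<close>
  define p where "p = (\<Prod>l\<in>UNIV. 1 + \<beta> l * x')"
  define q where "q = P * (\<Prod>k\<in>UNIV. minv (Q k))"
  have "1 + g * h - 1 \<in> max_ideal_power 1" if "g \<in> max_ideal_power 1" for g h :: "('k, 'l) B"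
    using max_ideal_power_mult_right[OF that] by simp
  then have p1: "p - 1 \<in> max_ideal_power 1"
    unfolding p_def by (intro one_plus_max_ideal_prod) (use \<beta> in blast)
  have q1: "q - 1 \<in> max_ideal_power 1"
    unfolding q_def by (intro one_plus_max_ideal_mult P1 one_plus_max_ideal_prod one_plus_max_ideal_inverse Q)
  obtain \<phi> where \<phi>: "R_hom \<phi>" "\<phi> x = x * p" "\<phi> y = y * q"
  proof -
    have "(x * p) * (x' * minv p) = (x * x') * (p * minv p)" by (simp only: mult_ac)
    then have 1: "(xy 1 0 * p) * (x' * minv p) = 1"
      using one_plus_max_ideal_inverse[OF p1] xx' by (simp add: x_def)
    have "(y * q) * (xy 0 (- 1) * minv q) = (y * xy 0 (- 1)) * (q * minv q)" by (simp only: mult_ac)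
    then have 2: "(xy 0 1 * q) * (xy 0 (- 1) * minv q) = 1"
      using one_plus_max_ideal_inverse[OF q1] by (simp add: y_def xy_mult)
    from R_hom_exists[OF 1 2] that show ?thesis unfolding x_def y_def by metis
  qed

  have "p - (\<Prod>l\<in>(UNIV :: 'l set). 1) \<in> filt (- 1) 1 n"
    unfolding p_def
    by (rule filt_prod_cong) (auto intro: filt_mult_left \<beta> filt_x simp: x'_def)
  then have p_lead: "p - 1 \<in> filt (- 1) 1 n" by simp
  have minv_D: "minv (\<Prod>l\<in>UNIV. D k l) = (\<Prod>l\<in>UNIV. E k l)" "minv (\<Prod>k\<in>UNIV. D k l) = (\<Prod>k\<in>UNIV. E k l)" for k l
    by (rule minv_eq; simp add: DE flip: prod.distrib)+
  have "minv (Q k) - (\<Prod>l\<in>UNIV. E k l) \<in> filt (- 1) 1 n" for k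
    unfolding minv_D[symmetric] by (intro filt_minv_cong one_plus_max_ideal_prod D1 Q filt_prod D0)
  then have "(\<Prod>k\<in>UNIV. minv (Q k)) - minv P \<in> filt (- 1) 1 n"
    unfolding PE by (intro filt_prod_cong filt_prod E0)
  from filt_mult_left[OF P0 this] have q_lead: "q - 1 \<in> filt (- 1) 1 n"
    by (simp add: q_def right_diff_distrib one_plus_max_ideal_inverse[OF P1])
  have lead_minus: "leading (- 1) n 1 1 \<phi>"
    unfolding leading_def using \<phi> p_lead q_lead by (auto simp: x_def y_def)

  define F where "F = (\<Prod>k\<in>UNIV. 1 + svar k * x)"
  define G where "G = (\<Prod>l\<in>UNIV. 1 + tvar l * y)"
  have F: "F \<in> ray_series (int 1) (int 0)" and G: "G \<in> ray_series (int 0) (int 1)"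
    unfolding F_def G_def x_def y_def svar_def tvar_def
    by (auto intro!: ray_series_prod simp: ray_series_one_plus)
  define \<tau> where "\<tau> = T (int 1) (int 0) F"
  have \<theta>: "\<theta> = \<tau> \<circ> T (int 0) (int 1) G"
    by (simp add: \<theta>_def \<tau>_def F_def G_def x_def y_def)
  have TF: "R_hom \<tau>" unfolding \<tau>_def by (rule R_hom_T[OF F])
  have F1: "F - 1 \<in> max_ideal_power 1" and G1: "G - 1 \<in> max_ideal_power 1"
    using F G by (auto simp: ray_series_def)
  define A where "A = (\<Prod>k\<in>UNIV. 1 + \<alpha> k * x)"
  have \<phi>F: "\<phi> F = A * (\<Prod>k\<in>UNIV. Q k)"
  proof -
    have "\<phi> F = (\<Prod>k\<in>UNIV. 1 + svar k * (x * p))"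
      by (simp add: F_def R_hom_prod[OF \<phi>(1)] R_hom_add[OF \<phi>(1)] R_hom_one[OF \<phi>(1)]
          R_hom_mult[OF \<phi>(1)] R_hom_svar[OF \<phi>(1)] \<phi>(2))
    then show ?thesis by (simp add: A_def p_def Q(1) prod.distrib flip: mult.assoc)
  qed
  have Q_inv: "Q k * minv (Q k) = 1" for k by (rule one_plus_max_ideal_inverse[OF Q(3)])
  have Q'_inv: "Q' k * minv (Q' k) = 1" for k by (rule one_plus_max_ideal_inverse[OF Q'(3)])
  have \<phi>y: "\<phi> y * \<phi> F = y * (P * A)"
  proof -
    have "\<phi> y * \<phi> F = y * (P * A) * ((\<Prod>k\<in>UNIV. Q k) * (\<Prod>k\<in>UNIV. minv (Q k)))"
      unfolding \<phi>F \<phi>(3) q_def by (simp only: mult_ac)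
    then show ?thesis by (simp add: Q_inv flip: prod.distrib)
  qed
  have TF_y: "\<tau> y = y * F" and TF_x: "\<tau> x = x"
    using T_x[OF F] T_y[OF F] by (simp_all add: x_def y_def \<tau>_def)
  have \<theta>_y: "(\<phi> \<circ> \<theta>) y = y * (P * A)"
  proof -
    have "T (int 0) (int 1) G y = y" using T_y[OF G] by (simp add: y_def)
    then show ?thesis by (simp only: \<theta> o_apply TF_y R_hom_mult[OF \<phi>(1)] \<phi>y)
  qed
  define H where "H = \<phi> (\<tau> G)"
  have H: "H = p * (\<Prod>l\<in>UNIV. Q' l)"
  proof -
    have "H = (\<Prod>l\<in>UNIV. 1 + tvar l * (y * (P * A)))"
      by (simp add: H_def G_def R_hom_prod[OF \<phi>(1)] R_hom_add[OF \<phi>(1)] R_hom_one[OF \<phi>(1)]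
          R_hom_mult[OF \<phi>(1)] R_hom_tvar[OF \<phi>(1)] R_hom_prod[OF TF] R_hom_add[OF TF] R_hom_one[OF TF]
          R_hom_mult[OF TF] R_hom_tvar[OF TF] TF_y \<phi>y)
    moreover have "tvar l * (y * (P * A)) = \<sigma> l * x' * A" for l
    proof -
      have "y = xy 1 1 * x'" by (simp add: y_def x'_def xy_mult)
      then show ?thesis by (simp add: \<sigma>_def mult_ac)
    qed
    ultimately show ?thesis by (simp add: A_def p_def Q'(1) prod.distrib)
  qed
  have H1: "H - 1 \<in> max_ideal_power 1"
    unfolding H_def by (rule R_hom_one_plus_max_ideal[OF \<phi>(1) R_hom_one_plus_max_ideal[OF TF G1]])
  have "(\<phi> \<circ> \<theta>) x = x * p * minv H"
  proof -
    have "T (int 0) (int 1) G x = x * minv G" using T_x[OF G] by (simp add: x_def)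
    then show ?thesis
      by (simp only: \<theta> o_apply TF_x R_hom_mult[OF \<phi>(1)] R_hom_mult[OF TF] \<phi>(2)
          R_hom_minv[OF TF G1] R_hom_minv[OF \<phi>(1) R_hom_one_plus_max_ideal[OF TF G1]] H_def)
  qed
  moreover have "p * minv H = (\<Prod>l\<in>UNIV. minv (Q' l))"
  proof (rule one_plus_max_ideal_cancel[OF H1])
    have "H * (p * minv H) = p * (H * minv H)" by (simp only: mult_ac)
    moreover have "H * (\<Prod>l\<in>UNIV. minv (Q' l)) = p"
      unfolding H by (simp add: mult.assoc Q'_inv flip: prod.distrib)
    ultimately show "H * (p * minv H) = H * (\<Prod>l\<in>UNIV. minv (Q' l))"
      by (simp add: one_plus_max_ideal_inverse[OF H1])
  qed
  ultimately have \<theta>_x: "(\<phi> \<circ> \<theta>) x = x * (\<Prod>l\<in>UNIV. minv (Q' l))"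
    by (simp add: mult.assoc)
  have "minv (Q' l) - (\<Prod>k\<in>UNIV. E k l) \<in> filt 1 1 n" for l
    unfolding minv_D[symmetric] by (intro filt_minv_cong one_plus_max_ideal_prod D1 Q' filt_prod D0)
  then have 1: "(\<Prod>l\<in>UNIV. minv (Q' l)) - minv P \<in> filt 1 1 n"
    unfolding PE' by (intro filt_prod_cong filt_prod E0)
  have "A - (\<Prod>k\<in>(UNIV :: 'k set). 1) \<in> filt 1 1 n"
    unfolding A_def
    by (rule filt_prod_cong) (auto intro: filt_mult_left \<alpha> filt_x simp: x_def)
  then have "P * (A - 1) \<in> filt 1 1 n" by (intro filt_mult_left P0) simp
  then have 2: "P * A - P \<in> filt 1 1 n" by (simp add: algebra_simps)
  have "leading 1 n (minv P) P (\<phi> \<circ> \<theta>)"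
    unfolding leading_def using \<theta>_x \<theta>_y 1 2 unfolding x_def y_def by blast
  with lead_minus \<phi>(1) that show ?thesis by blast
qed


unbundle fps_syntax

section \<open>The power series of Fuss and Catalan\<close>

text \<open>The number \<open>a / (a + p k) * ((a + p k) choose k)\<close>, with the denominator cancelled. It is the
  coefficient at \<open>z\<^sup>k\<close> of the \<open>a\<close>-th power of the Fuss-Catalan series \<open>D = 1 + z D\<^sup>p\<close>.\<close>

definition rothe :: "nat \<Rightarrow> nat \<Rightarrow> nat \<Rightarrow> rat" where
  "rothe p a k = (if k = 0 then 1
     else of_nat a * (\<Prod>i=1..<k. of_nat (a + p * k) - of_nat i) / fact k)"

lemma rothe_zero [simp]: "rothe p a 0 = 1" "k > 0 \<Longrightarrow> rothe p 0 k = 0"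
  by (simp_all add: rothe_def)

text \<open>The coefficients of \<open>D\<^sup>a\<^sup>+\<^sup>1 = D\<^sup>a + z D\<^sup>a\<^sup>+\<^sup>p\<close>, here obtained by direct calculation: for \<open>k > 0\<close>
  all three terms share the product \<open>W\<close>.\<close>

lemma rothe_difference: "rothe p (Suc a) (Suc k) = rothe p a (Suc k) + rothe p (a + p) k"
proof (cases k)
  case 0
  then show ?thesis by (simp add: rothe_def field_simps)
next
  case (Suc j)
  define M :: rat where "M = of_nat (a + p * (j + 2))"
  define W where "W = (\<Prod>i=1..<Suc j. M - of_nat i)"
  have "(\<Prod>i=1..<Suc (Suc j). M + 1 - of_nat i) = (\<Prod>i=0..<Suc j. M - of_nat i)"
    by (rule prod.reindex_bij_witness[of _ Suc "\<lambda>i. i - 1"]) (auto simp: of_nat_diff)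
  also have "\<dots> = M * W"
    unfolding W_def by (subst prod.atLeast_Suc_lessThan) (simp_all add: One_nat_def)
  finally have 1: "rothe p (Suc a) (Suc k) = of_nat (Suc a) * (M * W) / fact (j + 2)"
    by (simp add: rothe_def Suc M_def add_ac)
  have "rothe p a (Suc k) = of_nat a * (W * (M - of_nat (Suc j))) / fact (j + 2)"
    by (simp add: rothe_def Suc M_def W_def)
  moreover have "of_nat (a + p + p * Suc j) = M" by (simp add: M_def algebra_simps)
  then have "rothe p (a + p) k = of_nat (a + p) * W / fact (Suc j)"
    by (simp only: rothe_def Suc W_def nat.simps if_False)
  then have "rothe p (a + p) k = (of_nat (j + 2) * (of_nat (a + p) * W)) / (of_nat (j + 2) * fact (Suc j))"
    by (subst mult_divide_mult_cancel_left) simp_all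
  then have "rothe p (a + p) k = of_nat (a + p) * of_nat (j + 2) * W / fact (j + 2)"
    by (simp only: fact_Suc add_2_eq_Suc' mult_ac)
  moreover have "of_nat (Suc a) * (M * W) =
      of_nat a * (W * (M - of_nat (Suc j))) + of_nat (a + p) * of_nat (j + 2) * W"
    by (simp add: M_def algebra_simps)
  ultimately show ?thesis unfolding 1 by (simp add: add_divide_distrib)
qed

text \<open>The convolution identity of Rothe and Hagen: both sides agree for \<open>a = 0\<close>, and by
  \<open>rothe_difference\<close> their differences in \<open>a\<close> agree by induction on \<open>n\<close>.\<close>

lemma rothe_convolution: "(\<Sum>i=0..n. rothe p a i * rothe p b (n - i)) = rothe p (a + b) n"
proof (induction n arbitrary: a b)
  case (Suc n)
  show ?case
  proof (induction a)
    case 0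
    have "(\<Sum>i=0..Suc n. rothe p 0 i * rothe p b (Suc n - i)) =
        rothe p b (Suc n) + (\<Sum>i=Suc 0..Suc n. rothe p 0 i * rothe p b (Suc n - i))"
      by (subst sum.atLeast_Suc_atMost) simp_all
    also have "(\<Sum>i=Suc 0..Suc n. rothe p 0 i * rothe p b (Suc n - i)) = 0"
      by (rule sum.neutral) auto
    finally show ?case by simp
  next
    case (Suc a)
    have shift: "(\<Sum>i=0..Suc n. g i) = g 0 + (\<Sum>i=0..n. g (Suc i))" for g :: "nat \<Rightarrow> rat"
      by (simp add: sum.atLeast0_atMost_Suc_shift del: sum.cl_ivl_Suc)
    have "(\<Sum>i=0..Suc n. rothe p (Suc a) i * rothe p b (Suc n - i)) =
        (\<Sum>i=0..Suc n. rothe p a i * rothe p b (Suc n - i)) +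
        (\<Sum>i=0..n. rothe p (a + p) i * rothe p b (n - i))"
      unfolding shift by (simp add: rothe_difference algebra_simps sum.distrib)
    also have "\<dots> = rothe p (a + b) (Suc n) + rothe p ((a + b) + p) n"
      unfolding Suc.IH Suc.IH(1) \<open>\<And>a b. (\<Sum>i=0..n. rothe p a i * rothe p b (n - i)) = rothe p (a + b) n\<close>
      by (simp add: add_ac)
    finally show ?case by (simp add: rothe_difference)
  qed
qed simp

definition rothe_fps :: "nat \<Rightarrow> nat \<Rightarrow> rat fps" where
  "rothe_fps p a = Abs_fps (rothe p a)"

lemma rothe_fps_power: "rothe_fps p a ^ n = rothe_fps p (n * a)"
proof (induction n)
  case 0
  show ?case by (rule fps_ext) (simp add: rothe_fps_def)
next
  case (Suc n)
  have "rothe_fps p a * rothe_fps p b = rothe_fps p (a + b)" for b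
    by (rule fps_ext) (simp add: rothe_fps_def fps_mult_nth rothe_convolution)
  with Suc show ?case by simp
qed

lemma rothe_fps_equation: "rothe_fps p 1 = 1 + fps_X * rothe_fps p 1 ^ p"
proof (rule fps_ext)
  fix n
  have "rothe_fps p 1 ^ p = rothe_fps p p" by (simp add: rothe_fps_power)
  then show "rothe_fps p 1 $ n = (1 + fps_X * rothe_fps p 1 ^ p) $ n"
  proof (cases n)
    case (Suc k)
    then show ?thesis
      using rothe_difference[of p 0 k] \<open>rothe_fps p 1 ^ p = rothe_fps p p\<close>
      by (simp add: One_nat_def) (simp add: rothe_fps_def)
  qed (simp add: rothe_fps_def)
qed

lemma vertex_coeff_eq_rothe:
  assumes "1 \<le> l1" "1 \<le> l2"
  shows "vertex_coeff l1 l2 k = rothe ((l1 - 1) * (l2 - 1)) 1 k"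
proof -
  define p where "p = (l1 - 1) * (l2 - 1)"
  define N where "N = int l1 * int l2 - int l1 - int l2"
  have "int p = (int l1 - 1) * (int l2 - 1)"
    unfolding p_def of_nat_mult using assms by (simp add: of_nat_diff)
  then have p: "int p = N + 1" by (simp add: N_def algebra_simps)
  have "(\<Prod>i=2..k. of_int (N * int k + int i) :: rat) = (\<Prod>i=1..<k. of_nat (1 + p * k) - of_nat i)"
  proof (rule prod.reindex_bij_witness[of _ "\<lambda>i. Suc k - i" "\<lambda>i. Suc k - i"])
    fix i assume i: "i \<in> {2..k}"
    have "int (1 + p * k) - int (Suc k - i) = N * int k + int i"
      using i by (simp add: p of_nat_diff algebra_simps)
    then have "of_int (int (1 + p * k) - int (Suc k - i)) = (of_int (N * int k + int i) :: rat)"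
      by (rule arg_cong)
    then show "of_nat (1 + p * k) - of_nat (Suc k - i) = (of_int (N * int k + int i) :: rat)"
      by simp
  qed auto
  then show ?thesis
    using vertex_coeff_altdef[OF assms, of k] by (simp add: rothe_def flip: N_def p_def)
qed


section \<open>Specialization\<close>

lemma specialize_nth: "specialize g $ n = (\<Sum>m\<in>multisets_of_size UNIV n. mps_nth g m)"
  by (simp add: specialize_def)

lemma specialize_add: "specialize (g + h) = specialize g + specialize h"
  by (rule fps_ext) (simp add: specialize_nth sum.distrib)

lemma specialize_monom: "specialize (mps_monom m c) = fps_const c * fps_X ^ size m"
proof (rule fps_ext)
  fix n
  have "specialize (mps_monom m c) $ n = (if m \<in> multisets_of_size UNIV n then c else 0)"
    unfolding specialize_nth mps_monom.rep_eq by (rule sum.delta) (auto intro: finite_multisets_of_size)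
  also have "\<dots> = (fps_const c * fps_X ^ size m) $ n"
    by (simp add: multisets_of_size_def)
  finally show "specialize (mps_monom m c) $ n = (fps_const c * fps_X ^ size m) $ n" .
qed

lemma specialize_one: "specialize 1 = 1"
  using specialize_monom[of "{#}" 1] by (simp add: mps_monom_one)

lemma specialize_mult:
  fixes g h :: "('k::finite, 'l::finite) B"
  shows "specialize (g * h) = specialize g * specialize h"
proof (rule fps_ext)
  fix n
  let ?M = "multisets_of_size (UNIV :: ('k + 'l) set)"
  have fin: "finite (?M i)" for i by (rule finite_multisets_of_size) simp
  have "specialize (g * h) $ n = (\<Sum>m\<in>?M n. \<Sum>x\<in>msplits m. mps_nth g (fst x) * mps_nth h (snd x))"
    by (simp add: specialize_nth case_prod_unfold)
  also have "\<dots> = (\<Sum>(m, x)\<in>(SIGMA m:?M n. msplits m). mps_nth g (fst x) * mps_nth h (snd x))"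
    by (subst sum.Sigma) (auto simp: fin)
  also have "\<dots> = (\<Sum>(i, x)\<in>(SIGMA i:{0..n}. ?M i \<times> ?M (n - i)). mps_nth g (fst x) * mps_nth h (snd x))"
    by (rule sum.reindex_bij_witness[of _ "\<lambda>(i, x). (fst x + snd x, x)" "\<lambda>(m, x). (size (fst x), x)"])
      (auto simp: msplits_def multisets_of_size_def)
  also have "\<dots> = (\<Sum>i=0..n. \<Sum>x\<in>?M i \<times> ?M (n - i). mps_nth g (fst x) * mps_nth h (snd x))"
    by (subst sum.Sigma) (auto simp: fin)
  also have "\<dots> = (specialize g * specialize h) $ n"
    by (simp add: fps_mult_nth specialize_nth sum_product sum.cartesian_product case_prod_unfold)
  finally show "specialize (g * h) $ n = (specialize g * specialize h) $ n" .
qed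

lemma specialize_prod: "specialize (prod f A) = (\<Prod>i\<in>A. specialize (f i))"
  by (induction A rule: infinite_finite_induct) (simp_all add: specialize_one specialize_mult)

text \<open>The ring homomorphism that substitutes \<open>t\<^sup>2 x y\<close> for the variable; it transports the Fuss-Catalan
  equation from rational coefficients to Laurent polynomials.\<close>

definition diagonal_fps :: "rat fps \<Rightarrow> laurent fps" where
  "diagonal_fps g = Abs_fps (\<lambda>n. if even n
     then Poly_Mapping.single (int (n div 2), int (n div 2)) (g $ (n div 2)) else 0)"

lemma diagonal_fps_add: "diagonal_fps (g + h) = diagonal_fps g + diagonal_fps h"
  by (rule fps_ext) (simp add: diagonal_fps_def single_add)

lemma diagonal_fps_one: "diagonal_fps 1 = 1"
  by (rule fps_ext) (auto simp: diagonal_fps_def simp flip: zero_prod_def elim!: evenE)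

lemma diagonal_fps_mult: "diagonal_fps (g * h) = diagonal_fps g * diagonal_fps h"
proof (rule fps_ext)
  fix n
  show "diagonal_fps (g * h) $ n = (diagonal_fps g * diagonal_fps h) $ n"
  proof (cases "even n")
    case False
    then have "diagonal_fps g $ i * diagonal_fps h $ (n - i) = 0" if "i \<in> {0..n}" for i
      using that by (auto simp: diagonal_fps_def)
    then have "(diagonal_fps g * diagonal_fps h) $ n = 0"
      unfolding fps_mult_nth by (intro sum.neutral) blast
    then show ?thesis using False by (simp add: diagonal_fps_def)
  next
    case True
    then obtain k where n: "n = 2 * k" by blast
    have "(diagonal_fps g * diagonal_fps h) $ n =
        (\<Sum>i\<in>(\<lambda>j. 2 * j) ` {0..k}. diagonal_fps g $ i * diagonal_fps h $ (n - i))"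
      unfolding fps_mult_nth
      by (rule sum.mono_neutral_right) (auto simp: n diagonal_fps_def elim!: evenE)
    also have "\<dots> = (\<Sum>j=0..k. diagonal_fps g $ (2 * j) * diagonal_fps h $ (n - 2 * j))"
      by (subst sum.reindex) (auto simp: inj_on_def)
    also have "\<dots> = (\<Sum>j=0..k. Poly_Mapping.single (int k, int k) (g $ j * h $ (k - j)))"
    proof (rule sum.cong)
      fix j assume "j \<in> {0..k}"
      moreover from this have "n - 2 * j = 2 * (k - j)" by (simp add: n)
      ultimately show "diagonal_fps g $ (2 * j) * diagonal_fps h $ (n - 2 * j) =
          Poly_Mapping.single (int k, int k) (g $ j * h $ (k - j))"
        by (simp add: diagonal_fps_def mult_single of_nat_diff)
    qed simp
    also have "\<dots> = Poly_Mapping.single (int k, int k) (\<Sum>j=0..k. g $ j * h $ (k - j))"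
      by (induction rule: infinite_finite_induct) (simp_all add: single_add)
    finally show ?thesis by (simp add: diagonal_fps_def n fps_mult_nth)
  qed
qed

lemma diagonal_fps_power: "diagonal_fps (g ^ n) = diagonal_fps g ^ n"
  by (induction n) (simp_all add: diagonal_fps_one diagonal_fps_mult)

lemma diagonal_fps_X: "diagonal_fps fps_X = fps_X ^ 2 * fps_const (Poly_Mapping.single (1, 1) 1)"
  by (rule fps_ext) (auto simp: diagonal_fps_def One_nat_def elim!: evenE)

lemma diagonal_fps_suminf:
  "suminf (\<lambda>k. fps_const (Poly_Mapping.single 0 (g $ k)) *
      (fps_X ^ 2 * fps_const (Poly_Mapping.single (1, 1) 1)) ^ k) = diagonal_fps g"
proof (rule sums_unique[symmetric])
  define a where "a k = fps_const (Poly_Mapping.single (0 :: int \<times> int) (g $ k)) *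
      (fps_X ^ 2 * fps_const (Poly_Mapping.single (1, 1) 1)) ^ k" for k
  have power: "Poly_Mapping.single (1, 1) 1 ^ k = (Poly_Mapping.single (int k, int k) 1 :: laurent)" for k
    by (induction k) (simp_all add: mult_single flip: zero_prod_def)
  have a: "a k $ n = (if n = 2 * k then Poly_Mapping.single (int k, int k) (g $ k) else 0)" for k n
    by (simp add: a_def power_mult_distrib fps_const_power power mult_single mult.assoc[symmetric]
        fps_mult_right_const_nth flip: power_mult)
  have "a sums diagonal_fps g"
    unfolding sums_def
  proof (rule tendsto_fpsI)
    fix n
    show "\<forall>\<^sub>F N in sequentially. (\<Sum>k<N. a k) $ n = diagonal_fps g $ n"
    proof (rule eventually_mono[OF eventually_gt_at_top[of n]])
      fix N assume "n < N"
      have "(\<Sum>k<N. a k) $ n = (\<Sum>k<N. if n = 2 * k then Poly_Mapping.single (int k, int k) (g $ k) else 0)"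
        by (simp add: fps_sum_nth a)
      also have "\<dots> = (\<Sum>k<N. if k = n div 2 then diagonal_fps g $ n else 0)"
        by (rule sum.cong) (auto simp: diagonal_fps_def elim!: evenE)
      also have "\<dots> = diagonal_fps g $ n" using \<open>n < N\<close> by simp
      finally show "(\<Sum>k<N. a k) $ n = diagonal_fps g $ n" .
    qed
  qed
  then show "(\<lambda>k. fps_const (Poly_Mapping.single 0 (g $ k)) *
      (fps_X ^ 2 * fps_const (Poly_Mapping.single (1, 1) 1)) ^ k) sums diagonal_fps g"
    unfolding a_def .
qed

lemma dvd_prod_diff:
  fixes f g :: "'a \<Rightarrow> 'b::comm_ring_1"
  assumes "\<And>i. i \<in> A \<Longrightarrow> d dvd f i - g i"
  shows "d dvd prod f A - prod g A"
  using assms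
proof (induction A rule: infinite_finite_induct)
  case (insert a A)
  then have "d dvd (f a - g a) * prod f A + g a * (prod f A - prod g A)"
    by (intro dvd_add dvd_mult dvd_mult2) auto
  then show ?case using insert.hyps by (simp add: algebra_simps)
qed auto

text \<open>The constant family with value the Fuss-Catalan series solves the specialized system, and the
  solution is unique because the right-hand sides are contractions for the \<open>t\<close>-adic topology.\<close>

lemma specialize_vertex_system:
  fixes D :: "'k::finite \<Rightarrow> 'l::finite \<Rightarrow> ('k, 'l) B"
  assumes D: "vertex_system D"
  shows "specialize (D k l) = diagonal_fps (rothe_fps ((CARD('k) - 1) * (CARD('l) - 1)) 1)"
proof -
  define S where "S = diagonal_fps (rothe_fps ((CARD('k) - 1) * (CARD('l) - 1)) 1)"
  define u :: "laurent fps" where "u = fps_X ^ 2 * fps_const (Poly_Mapping.single (1, 1) 1)"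
  have "S = 1 + u * S ^ ((CARD('k) - 1) * (CARD('l) - 1))"
    unfolding S_def u_def
    by (subst rothe_fps_equation)
      (simp add: diagonal_fps_add diagonal_fps_one diagonal_fps_mult diagonal_fps_X diagonal_fps_power)
  then have S: "S = 1 + u * (\<Prod>i\<in>- {k}. \<Prod>j\<in>- {l}. S)" for k :: 'k and l :: 'l
    by (simp add: Compl_eq_Diff_UNIV card_Diff_singleton mult.commute flip: power_mult)
  have spec: "specialize (D k l) = 1 + u * (\<Prod>i\<in>- {k}. \<Prod>j\<in>- {l}. specialize (D i j))" for k l
  proof -
    have "svar k * tvar l * xy 1 1 = (mps_monom {#Inl k, Inr l#} (Poly_Mapping.single (1, 1) 1) :: ('k, 'l) B)"
      by (simp add: svar_def tvar_def xy_def mps_monom_mult add_mset_commute)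
    then have "specialize (svar k * tvar l * xy 1 1 :: ('k, 'l) B) = u"
      by (simp add: specialize_monom u_def mult.commute numeral_2_eq_2)
    moreover have "specialize (D k l) =
        specialize (1 + svar k * tvar l * xy 1 1 * (\<Prod>i\<in>- {k}. \<Prod>j\<in>- {l}. D i j))"
      using D unfolding vertex_system_def by metis
    ultimately show ?thesis
      unfolding specialize_add specialize_mult specialize_prod specialize_one
      by (simp only: specialize_mult)
  qed
  have dvd: "fps_X ^ n dvd specialize (D k l) - S" for n k l
  proof (induction n arbitrary: k l)
    case (Suc n)
    have "specialize (D k l) - S =
        u * ((\<Prod>i\<in>- {k}. \<Prod>j\<in>- {l}. specialize (D i j)) - (\<Prod>i\<in>- {k}. \<Prod>j\<in>- {l}. S))"
      by (subst spec, subst S[where k = k and l = l]) (simp add: algebra_simps)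
    moreover have "fps_X dvd u" by (simp add: u_def power2_eq_square)
    moreover have "fps_X ^ n dvd (\<Prod>i\<in>- {k}. \<Prod>j\<in>- {l}. specialize (D i j)) - (\<Prod>i\<in>- {k}. \<Prod>j\<in>- {l}. S)"
      by (intro dvd_prod_diff Suc)
    ultimately show ?case by (simp add: mult_dvd_mono)
  qed simp
  have "specialize (D k l) = S"
  proof (rule fps_ext)
    fix n
    obtain h where "specialize (D k l) - S = fps_X ^ Suc n * h" using dvd by blast
    then have "(specialize (D k l) - S) $ n = 0"
      by (simp only: fps_X_power_mult_nth) simp
    then show "specialize (D k l) $ n = S $ n" by simp
  qed
  then show ?thesis by (simp add: S_def)
qed


section \<open>The ray of slope 1\<close>

lemma slope_gt_trans: "slope_gt u v \<Longrightarrow> slope_gt v w \<Longrightarrow> slope_gt u w"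
proof -
  assume *: "slope_gt u v" "slope_gt v w"
  obtain a b a' b' a'' b'' where [simp]: "u = (a, b)" "v = (a', b')" "w = (a'', b'')"
    by (metis surj_pair)
  have 1: "b' * a < b * a'" "b'' * a' < b' * a''" using * by (simp_all add: slope_gt_def)
  then have "0 < a''" "0 < a'" by (auto intro: Nat.gr0I)
  have "(b'' * a) * a' \<le> (b' * a) * a''"
    using mult_le_mono1[OF less_imp_le[OF 1(2)], of a] by (simp add: mult_ac)
  also have "\<dots> < (b * a') * a''" by (rule mult_less_mono1[OF 1(1) \<open>0 < a''\<close>])
  also have "\<dots> = (b * a'') * a'" by (simp only: mult_ac)
  finally have "b'' * a < b * a''" by (simp only: mult_less_cancel2)
  then show "slope_gt u w" by (simp add: slope_gt_def)
qed

lemma slope_gt_total: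
  assumes "u \<in> coprime_pairs" "v \<in> coprime_pairs" "u \<noteq> v"
  shows "slope_gt u v \<or> slope_gt v u"
proof (rule ccontr)
  obtain a b a' b' where [simp]: "u = (a, b)" "v = (a', b')" by (metis surj_pair)
  assume "\<not> (slope_gt u v \<or> slope_gt v u)"
  then have "b * a' = b' * a" by (simp add: slope_gt_def)
  moreover have "coprime b a" "coprime b' a'" using assms by (simp_all add: coprime_pairs_def coprime_commute)
  ultimately have "b = b' \<and> a' = a" using coprime_crossproduct_nat[of b a b' a'] by (simp add: coprime_commute)
  with assms(3) show False by simp
qed

lemma sorted_by_slope_exists:
  assumes "finite S" "S \<subseteq> coprime_pairs"
  obtains ps where "sorted_wrt slope_gt ps" "set ps = S"
proof -
  have "\<exists>ps. sorted_wrt slope_gt ps \<and> set ps = S"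
    using assms
  proof (induction S rule: finite_induct)
    case (insert v S)
    then obtain ps where ps: "sorted_wrt slope_gt ps" "set ps = S" by auto
    let ?ps = "filter (\<lambda>u. slope_gt u v) ps @ v # filter (slope_gt v) ps"
    have "sorted_wrt slope_gt ?ps"
      using ps by (auto simp: sorted_wrt_append sorted_wrt_filter intro: slope_gt_trans)
    moreover have "set ?ps = insert v S"
      using ps(2) insert.prems insert.hyps slope_gt_total[of _ v] by fastforce
    ultimately show ?case by blast
  qed simp
  with that show ?thesis by blast
qed

text \<open>Modulo \<open>\<mm>\<^sup>n\<close>, \<open>\<theta>\<close> is a finite ordered product, which splits at \<open>(1, 1)\<close> into the factors of slope
  greater and less than 1; the curves then determine the middle factor.\<close>

theorem vertex_series_slope_one:
  fixes f :: "nat \<times> nat \<Rightarrow> ('k::finite, 'l::finite) B"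
  assumes fact: "ordered_factorization
      (T 1 0 (\<Prod>k\<in>UNIV. 1 + svar k * xy 1 0) \<circ> T 0 1 (\<Prod>l\<in>UNIV. 1 + tvar l * xy 0 1)) f"
    and D: "vertex_system D"
  shows "f (1, 1) = (\<Prod>k\<in>UNIV. \<Prod>l\<in>UNIV. D k l)"
proof (rule separated)
  fix n
  define P where "P = (\<Prod>k\<in>UNIV. \<Prod>l\<in>UNIV. D k l)"
  define \<theta> :: "('k, 'l) B \<Rightarrow> ('k, 'l) B" where
    "\<theta> = T 1 0 (\<Prod>k\<in>UNIV. 1 + svar k * xy 1 0) \<circ> T 0 1 (\<Prod>l\<in>UNIV. 1 + tvar l * xy 0 1)"
  have vs: "f v \<in> vertex_series (int (fst v)) (int (snd v))" if "v \<in> coprime_pairs" for v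
    using fact that unfolding ordered_factorization_def by (cases v) auto
  obtain S where S: "finite S" "S \<subseteq> coprime_pairs"
    "\<And>ps. sorted_wrt slope_gt ps \<Longrightarrow> set ps \<subseteq> coprime_pairs \<Longrightarrow> S \<subseteq> set ps \<Longrightarrow>
      cong_max_ideal_power n (T_product f ps) \<theta>"
    using fact unfolding ordered_factorization_def \<theta>_def by meson
  have one: "(1, 1) \<in> coprime_pairs" by (simp add: coprime_pairs_def)
  obtain zs where zs: "sorted_wrt slope_gt zs" "set zs = insert (1, 1) S"
    using sorted_by_slope_exists[of "insert (1, 1) S"] S one by auto
  then obtain ps qs where split: "zs = ps @ (1, 1) # qs" by (metis insertI1 split_list)
  have cp: "set ps \<union> {(1, 1)} \<union> set qs \<subseteq> coprime_pairs"
    using zs(2) S(2) one unfolding split by auto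
  have cong: "cong_max_ideal_power n (T_product f zs) \<theta>"
    by (rule S(3)) (use zs S(2) one in auto)
  obtain \<phi> where \<phi>: "R_hom \<phi>" "leading (- 1) n 1 1 \<phi>" "leading 1 n (minv P) P (\<phi> \<circ> \<theta>)"
    using vertex_curve[OF D, of n] unfolding P_def \<theta>_def by blast
  have "\<phi> (\<theta> g) - \<phi> (T_product f zs g) \<in> max_ideal_power n" for g
  proof -
    have "0 - (T_product f zs g - \<theta> g) \<in> max_ideal_power n"
      using cong unfolding cong_max_ideal_power_def by (intro max_ideal_power_diff[OF max_ideal_power_zero]) blast
    then have "\<theta> g - T_product f zs g \<in> max_ideal_power n" by simp
    from R_linear_continuous[OF R_hom_linear[OF \<phi>(1)] this]
    show ?thesis by (simp add: R_linear_diff[OF R_hom_linear[OF \<phi>(1)]])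
  qed
  then have lead: "leading 1 n (minv P) P (\<phi> \<circ> T_product f (ps @ (1, 1) # qs))"
    using leading_cong[OF \<phi>(3)] by (simp add: split)
  have P1: "P - 1 \<in> max_ideal_power 1" and P0: "P \<in> filt e 0 n" for e
    unfolding P_def by (intro one_plus_max_ideal_prod vertex_system_one_plus[OF D])
      (intro filt_prod vertex_system_filt[OF D])
  have "f (1, 1) - P \<in> max_ideal_power n"
  proof (rule vertex_series_from_leading[OF _ _ _ \<phi>(1,2) lead])
    show "fst v < snd v" if "v \<in> set ps" for v
      using zs(1) that unfolding split by (auto simp: sorted_wrt_append slope_gt_def)
    show "snd v < fst v" if "v \<in> set qs" for v
      using zs(1) that unfolding split by (auto simp: sorted_wrt_append slope_gt_def)
    show "minv P * P = 1" using one_plus_max_ideal_inverse(1)[OF P1] by (simp add: mult.commute)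
    show "minv P \<in> filt e 0 n" for e by (rule filt_minv[OF P1 P0])
  qed (use vs cp P0 in auto)
  then show "f (1, 1) - (\<Prod>k\<in>UNIV. \<Prod>l\<in>UNIV. D k l) \<in> max_ideal_power n"
    by (simp add: P_def)
qed

theorem corollary11p2:
  fixes f :: "nat \<times> nat \<Rightarrow> ('k::finite, 'l::finite) B"
    and l1 l2 :: nat
  assumes "l1 = CARD('k)" and "l2 = CARD('l)"
    and "ordered_factorization
           (T 1 0 (\<Prod>k\<in>UNIV. 1 + svar k * xy 1 0) \<circ> T 0 1 (\<Prod>l\<in>UNIV. 1 + tvar l * xy 0 1)) f"
  shows "specialize (f (1, 1)) =
           (suminf (\<lambda>k. fps_const (Poly_Mapping.single 0 (vertex_coeff l1 l2 k)) *
                 (fps_X ^ 2 * fps_const (Poly_Mapping.single (1, 1) 1)) ^ k)) ^ (l1 * l2)"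
proof -
  obtain D :: "'k \<Rightarrow> 'l \<Rightarrow> ('k, 'l) B" where D: "vertex_system D" by (rule vertex_system_exists)
  define g where "g = rothe_fps ((l1 - 1) * (l2 - 1)) 1"
  have pos: "1 \<le> l1" "1 \<le> l2"
    using assms(1,2) by (simp_all add: Suc_leI One_nat_def)
  have "specialize (f (1, 1)) = (\<Prod>k\<in>(UNIV :: 'k set). \<Prod>l\<in>(UNIV :: 'l set). diagonal_fps g)"
    using vertex_series_slope_one[OF assms(3) D] specialize_vertex_system[OF D] assms(1,2)
    by (simp add: specialize_prod g_def)
  also have "\<dots> = diagonal_fps g ^ (l1 * l2)"
    by (simp add: assms(1,2) mult.commute flip: power_mult)
  also have "g $ k = vertex_coeff l1 l2 k" for k
    by (simp add: g_def rothe_fps_def vertex_coeff_eq_rothe[OF pos])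
  then have "diagonal_fps g = suminf (\<lambda>k. fps_const (Poly_Mapping.single 0 (vertex_coeff l1 l2 k)) *
      (fps_X ^ 2 * fps_const (Poly_Mapping.single (1, 1) 1)) ^ k)"
    using diagonal_fps_suminf[of g] by simp
  finally show ?thesis .
qed

end
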